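(* Let $\mathcal{M}$ be a smooth manifold and let $D(J_0)$ be an open subset of $\mathcal{M}\times\mathcal{G}_{n,r}$ on which a real non-negative-valued function $J_0$ is defined and continuously differentiable. Suppose that there is a finite constant $M$ so that the set $S_M=\{(x,\mathcal{V})\in D(J_0) : J_0(x,\mathcal{V})\le M\}$ is compact and contains a point $(x_0,\mathcal{V}_0)$ with $R_{1,2}(\mathcal{V}_0)=0$. Then for any $\gamma\ge 0$, the function on $D(J_0)$ defined by $$J_\gamma(x,\mathcal{V})=J_0(x,\mathcal{V})+\gamma R_{1,2}(\mathcal{V})$$ attains its minimum and all such minimizers lie in $S_M$. Furthermore, there is a constant $\Gamma\ge 0$ so that when $\gamma>\Gamma$, every minimizer $(x_*,\mathcal{V}_* )$ of $J_\gamma$ satisfies $R_{1,2}(\mathcal{V}_* )=0$.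
   Context: Let $n\ge r\ge1$ be integers. $\mathcal{G}_{n,r}$ denotes the Grassmann manifold of $r$-dimensional subspaces of $\mathbb{R}^n$ with its usual smooth structure. For a real $n\times r$ matrix $U$, let $\|U\|_{1,2}=\sum_{i=1}^n\|\mathrm{row}_i(U)\|_2$ be the sum of the Euclidean norms of its rows. For $\mathcal{V}\in\mathcal{G}_{n,r}$ define $R_{1,2}(\mathcal{V})=\|U\|_{1,2}-r$, where $U\in\mathbb{R}^{n\times r}$ is any matrix with orthonormal columns spanning $\mathcal{V}$; this does not depend on the choice of $U$. *)

theory Defs
  imports "HOL-Analysis.Analysis"
begin

text \<open>
  The model space of a \<open>d\<close>-dimensional manifold is the library topology
  \<^const>\<open>Euclidean_space\<close> \<open>d\<close>, whose points are the sequences vanishing from index \<open>d\<close> on.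
  Dimension \<open>0\<close> is thereby included, which is needed for the Grassmannian with \<open>r = n\<close>.
\<close>

definition partial_deriv :: "nat \<Rightarrow> ((nat \<Rightarrow> real) \<Rightarrow> real) \<Rightarrow> (nat \<Rightarrow> real) \<Rightarrow> real"
  where "partial_deriv i f y = deriv (\<lambda>t. f (y(i := t))) (y i)"

text \<open>
  Intended for \<open>S\<close> open in \<open>Euclidean_space d\<close>; then only the values of \<open>f\<close> on \<open>S\<close> matter.
\<close>

primrec Ck_on :: "nat \<Rightarrow> nat \<Rightarrow> (nat \<Rightarrow> real) set \<Rightarrow> ((nat \<Rightarrow> real) \<Rightarrow> real) \<Rightarrow> bool"
  where
    "Ck_on 0 d S f \<longleftrightarrow> continuous_map (subtopology (Euclidean_space d) S) euclideanreal f"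
  | "Ck_on (Suc k) d S f \<longleftrightarrow>
       continuous_map (subtopology (Euclidean_space d) S) euclideanreal f \<and>
       (\<forall>i<d. (\<forall>y\<in>S. (\<lambda>t. f (y(i := t))) differentiable (at (y i))) \<and>
              Ck_on k d S (partial_deriv i f))"

text \<open>A chart is a pair of its domain and its coordinate map, the latter only relevant on the domain.\<close>

type_synonym 'a chart = "'a set \<times> ('a \<Rightarrow> nat \<Rightarrow> real)"

text \<open>
  \<open>\<A>\<close> is any smooth atlas, not necessarily the maximal one; it determines the smooth structure.
\<close>

definition smooth_manifold :: "nat \<Rightarrow> 'a topology \<Rightarrow> 'a chart set \<Rightarrow> bool"
  where "smooth_manifold d X \<A> \<longleftrightarrow>
    Hausdorff_space X \<and> second_countable X \<and>
    (\<forall>(U, \<phi>)\<in>\<A>. openin X U \<and> openin (Euclidean_space d) (\<phi> ` U) \<and>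
       homeomorphic_map (subtopology X U) (subtopology (Euclidean_space d) (\<phi> ` U)) \<phi>) \<and>
    \<Union> (fst ` \<A>) = topspace X \<and>
    (\<forall>(U, \<phi>)\<in>\<A>. \<forall>(V, \<psi>)\<in>\<A>. \<forall>i<d. \<forall>k.
       Ck_on k d (\<phi> ` (U \<inter> V)) (\<lambda>y. \<psi> (inv_into U \<phi> y) i))"

definition Ck_on_manifold :: "nat \<Rightarrow> nat \<Rightarrow> 'a chart set \<Rightarrow> 'a set \<Rightarrow> ('a \<Rightarrow> real) \<Rightarrow> bool"
  where "Ck_on_manifold k d \<A> D f \<longleftrightarrow>
    (\<forall>(U, \<phi>)\<in>\<A>. Ck_on k d (\<phi> ` (U \<inter> D)) (\<lambda>y. f (inv_into U \<phi> y)))"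

text \<open>
  The product atlas, where \<open>d\<close> is the dimension of the first factor: the coordinates of the
  second factor are appended to the first \<open>d\<close> coordinates.
\<close>

definition product_atlas :: "nat \<Rightarrow> 'a chart set \<Rightarrow> 'b chart set \<Rightarrow> ('a \<times> 'b) chart set"
  where "product_atlas d \<A> \<B> =
    {(U \<times> V, \<lambda>(x, y) i. if i < d then \<phi> x i else \<psi> y (i - d)) | U \<phi> V \<psi>.
       (U, \<phi>) \<in> \<A> \<and> (V, \<psi>) \<in> \<B>}"

text \<open>
  Here \<open>n = CARD('n)\<close> and \<open>r = CARD('r)\<close>; a real \<open>n \<times> r\<close> matrix has type \<open>real^'r^'n\<close>.
\<close>

definition grassmannian :: "'r::finite itself \<Rightarrow> (real^'n) set set"
  where "grassmannian _ = {V. subspace V \<and> dim V = CARD('r)}"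

definition grassmannian_dim :: "'r::finite itself \<Rightarrow> 'n::finite itself \<Rightarrow> nat"
  where "grassmannian_dim _ _ = CARD('r) * (CARD('n) - CARD('r))"

definition colspan :: "real^'r^'n \<Rightarrow> (real^'n) set"
  where "colspan U = span (columns U)"

definition full_rank :: "(real^'r^'n) set"
  where "full_rank = {U. rank U = CARD('r)}"

text \<open>The quotient topology with respect to \<^const>\<open>colspan\<close> on the matrices of full column rank.\<close>

definition grassmann_open :: "'r::finite itself \<Rightarrow> (real^'n) set set \<Rightarrow> bool"
  where "grassmann_open _ W \<longleftrightarrow>
    W \<subseteq> grassmannian TYPE('r) \<and>
    openin (top_of_set full_rank) {U::real^'r^'n. U \<in> full_rank \<and> colspan U \<in> W}"

definition grassmann_topology :: "'r::finite itself \<Rightarrow> (real^'n) set topology"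
  where "grassmann_topology T = topology (grassmann_open T)"

text \<open>
  For \<open>r\<close> selected rows, listed by an injective \<open>\<sigma>\<close>, the standard chart is defined on the
  subspaces spanned by the columns of a matrix whose selected rows form the identity matrix.
  That matrix is then unique, and its remaining \<open>r * (n - r)\<close> entries, enumerated by \<open>e\<close>, are the
  coordinates.
\<close>

definition normal_frames :: "('r::finite \<Rightarrow> 'n::finite) \<Rightarrow> (real^'r^'n) set"
  where "normal_frames \<sigma> = {U. \<forall>i j. U $ \<sigma> i $ j = (if i = j then 1 else 0)}"

definition grassmann_coords ::
    "('r::finite \<Rightarrow> 'n::finite) \<Rightarrow> (nat \<Rightarrow> 'n \<times> 'r) \<Rightarrow> (real^'n) set \<Rightarrow> nat \<Rightarrow> real"
  where "grassmann_coords \<sigma> e V k =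
    (if k < grassmannian_dim TYPE('r) TYPE('n)
     then (THE U. U \<in> normal_frames \<sigma> \<and> colspan U = V) $ fst (e k) $ snd (e k) else 0)"

definition grassmann_atlas :: "'r::finite itself \<Rightarrow> (real^'n) set chart set"
  where "grassmann_atlas _ =
    {(colspan ` normal_frames \<sigma>, grassmann_coords \<sigma> e) | (\<sigma> :: 'r \<Rightarrow> 'n) e.
       inj \<sigma> \<and> bij_betw e {..<grassmannian_dim TYPE('r) TYPE('n)} ((- range \<sigma>) \<times> UNIV)}"

definition norm12 :: "real^'r^'n \<Rightarrow> real"
  where "norm12 U = (\<Sum>i\<in>UNIV. norm (row i U))"

definition orthonormal_frame :: "(real^'n) set \<Rightarrow> real^'r^'n \<Rightarrow> bool"
  where "orthonormal_frame V U \<longleftrightarrow> transpose U ** U = mat 1 \<and> colspan U = V"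

definition R12 :: "'r::finite itself \<Rightarrow> (real^'n) set \<Rightarrow> real"
  where "R12 _ V = norm12 (SOME U::real^'r^'n. orthonormal_frame V U) - real CARD('r)"

definition penalized ::
    "'r::finite itself \<Rightarrow> ('m \<times> (real^'n) set \<Rightarrow> real) \<Rightarrow> real \<Rightarrow> 'm \<times> (real^'n) set \<Rightarrow> real"
  where "penalized T J \<gamma> = (\<lambda>(x, V). J (x, V) + \<gamma> * R12 T V)"

lemma colspan_range: "colspan (U::real^'r^'n) = range ((*v) U)"
proof
  show "colspan U \<subseteq> range ((*v) U)"
    unfolding colspan_def
  proof (rule span_minimal)
    show "columns U \<subseteq> range ((*v) U)"
      by (auto simp: columns_def) (metis matrix_vector_mult_basis rangeI)
  qed (simp add: linear_subspace_image)
  show "range ((*v) U) \<subseteq> colspan U"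
    unfolding colspan_def using matrix_vector_mult_in_columnspace by blast
qed

lemma colspan_in_grassmannian_iff:
  "colspan (U::real^'r^'n) \<in> grassmannian TYPE('r) \<longleftrightarrow> U \<in> full_rank"
  by (simp add: grassmannian_def full_rank_def colspan_def column_rank_def)

lemma ex_orthonormal_frame:
  fixes V :: "(real^'n) set"
  assumes "V \<in> grassmannian TYPE('r::finite)"
  shows "\<exists>U::real^'r^'n. orthonormal_frame V U"
proof -
  have V: "subspace V" "dim V = CARD('r)"
    using assms by (auto simp: grassmannian_def)
  obtain B where B: "B \<subseteq> V" "pairwise orthogonal B" "\<And>x. x \<in> B \<Longrightarrow> norm x = 1"
    "independent B" "card B = dim V" "span B = V"
    using orthonormal_basis_subspace[OF V(1)] by metis
  have "finite B"
    using B(4) independent_imp_finite by blast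
  then obtain b where b: "bij_betw b (UNIV::'r set) B"
    using B(5) V(2) by (metis finite finite_same_card_bij)
  define U :: "real^'r^'n" where "U = (\<chi> i j. b j $ i)"
  have col: "column j U = b j" for j
    by (simp add: U_def column_def vec_eq_iff)
  have "columns U = B"
    using b by (auto simp: columns_def col bij_betw_def)
  moreover have "transpose U ** U = mat 1"
  proof -
    have "b i \<bullet> b j = (if i = j then 1 else 0)" for i j
    proof (cases "i = j")
      case True
      have "norm (b i) = 1"
        using B(3) b by (auto simp: bij_betw_def)
      with True show ?thesis
        by (simp add: dot_square_norm)
    next
      case False
      then have "b i \<noteq> b j"
        using b by (auto simp: bij_betw_def inj_on_def)
      with False B(2) b show ?thesis
        by (auto simp: pairwise_def orthogonal_def bij_betw_def)
    qed
    then show ?thesis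
      by (simp add: vec_eq_iff matrix_matrix_mult_def transpose_def mat_def U_def inner_vec_def)
  qed
  ultimately have "orthonormal_frame V U"
    using B(6) by (simp add: orthonormal_frame_def colspan_def)
  then show ?thesis ..
qed

lemma orthonormal_frame_projection:
  fixes U W :: "real^'r^'n"
  assumes "orthonormal_frame V U" "orthonormal_frame V W"
  shows "(U ** transpose U) ** W = W"
proof -
  have U: "transpose U ** U = mat 1" and eq: "range ((*v) U) = range ((*v) W)"
    using assms by (auto simp: orthonormal_frame_def colspan_range)
  have "((U ** transpose U) ** W) *v x = W *v x" for x
  proof -
    obtain z where z: "W *v x = U *v z"
      using eq by (metis rangeE rangeI)
    have "((U ** transpose U) ** W) *v x = (U ** (transpose U ** U)) *v z"
      using z by (simp flip: matrix_vector_mul_assoc)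
    with z U show ?thesis by simp
  qed
  then show ?thesis
    by (simp add: matrix_eq)
qed

lemma R12_eq:
  fixes U :: "real^'r^'n"
  assumes "orthonormal_frame V U"
  shows "R12 TYPE('r) V = norm12 U - real CARD('r)"
proof -
  define W :: "real^'r^'n" where "W = (SOME U. orthonormal_frame V U)"
  have W: "orthonormal_frame V W"
    unfolding W_def using assms by (rule someI)
  have "U ** transpose U ** (W ** transpose W) = W ** transpose W"
    using orthonormal_frame_projection[OF assms W] by (simp add: matrix_mul_assoc)
  moreover have "W ** transpose W ** (U ** transpose U) = U ** transpose U"
    using orthonormal_frame_projection[OF W assms] by (simp add: matrix_mul_assoc)
  ultimately have eq: "U ** transpose U = W ** transpose W"
    by (metis matrix_transpose_mul transpose_transpose)
  have diag: "(A ** transpose A) $ i $ i = row i A \<bullet> row i A" for A :: "real^'r^'n" and i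
    by (simp add: matrix_matrix_mult_def transpose_def row_def inner_vec_def)
  have "norm (row i U) = norm (row i W)" for i
    using diag[of U i] diag[of W i] eq by (simp add: norm_eq_sqrt_inner)
  then show ?thesis
    by (simp add: R12_def norm12_def flip: W_def)
qed

lemma istopology_grassmann_open:
  "istopology (grassmann_open T :: (real^'n) set set \<Rightarrow> bool)" for T :: "'r::finite itself"
  unfolding istopology_def
proof (intro conjI allI impI)
  fix W W' :: "(real^'n) set set" assume "grassmann_open T W" "grassmann_open T W'"
  moreover have "{U::real^'r^'n. U \<in> full_rank \<and> colspan U \<in> W \<inter> W'} =
      {U. U \<in> full_rank \<and> colspan U \<in> W} \<inter> {U. U \<in> full_rank \<and> colspan U \<in> W'}"
    by auto
  ultimately show "grassmann_open T (W \<inter> W')"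
    by (auto simp: grassmann_open_def intro: openin_Int)
next
  fix \<K> :: "(real^'n) set set set" assume K: "\<forall>K\<in>\<K>. grassmann_open T K"
  have "{U::real^'r^'n. U \<in> full_rank \<and> colspan U \<in> \<Union>\<K>} =
      (\<Union>K\<in>\<K>. {U. U \<in> full_rank \<and> colspan U \<in> K})"
    by auto
  with K show "grassmann_open T (\<Union>\<K>)"
    by (auto simp: grassmann_open_def)
qed

lemma openin_grassmann_topology: "openin (grassmann_topology T) = grassmann_open T"
  unfolding grassmann_topology_def using istopology_grassmann_open by (rule topology_inverse')

lemma topspace_grassmann_topology:
  "topspace (grassmann_topology TYPE('r::finite)) = (grassmannian TYPE('r) :: (real^'n) set set)"
proof -
  have "grassmann_open TYPE('r) (grassmannian TYPE('r) :: (real^'n) set set)"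
    by (simp add: grassmann_open_def colspan_in_grassmannian_iff)
  then show ?thesis
    unfolding topspace_def openin_grassmann_topology by (auto simp: grassmann_open_def)
qed

lemma quotient_map_colspan:
  "quotient_map (top_of_set full_rank) (grassmann_topology TYPE('r))
     (colspan :: real^'r^'n \<Rightarrow> (real^'n) set)"
proof -
  have "colspan ` (full_rank :: (real^'r^'n) set) = grassmannian TYPE('r)"
  proof
    show "grassmannian TYPE('r) \<subseteq> colspan ` (full_rank :: (real^'r^'n) set)"
    proof
      fix V :: "(real^'n) set" assume "V \<in> grassmannian TYPE('r)"
      moreover from this obtain U :: "real^'r^'n" where "colspan U = V"
        using ex_orthonormal_frame unfolding orthonormal_frame_def by blast
      ultimately show "V \<in> colspan ` (full_rank :: (real^'r^'n) set)"
        using colspan_in_grassmannian_iff by blast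
    qed
  qed (use colspan_in_grassmannian_iff in blast)
  then show ?thesis
    by (simp add: quotient_map_def topspace_grassmann_topology openin_grassmann_topology
        grassmann_open_def)
qed

lemma normal_frames_full_rank:
  fixes U :: "real^'r^'n"
  assumes "U \<in> normal_frames \<sigma>"
  shows "U \<in> full_rank"
proof -
  have "(U *v x) $ \<sigma> i = x $ i" for x i
    using assms by (simp add: normal_frames_def matrix_vector_mult_def if_distrib
        [where f = "\<lambda>c. c * _"] cong: if_cong)
  then have "inj ((*v) U)"
    by (metis injI vec_eq_iff)
  then show ?thesis
    by (simp add: full_rank_def full_rank_injective)
qed

lemma inj_on_colspan_normal_frames:
  "inj_on colspan (normal_frames \<sigma> :: (real^'r^'n) set)"
proof (rule inj_onI)
  fix U W :: "real^'r^'n"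
  assume U: "U \<in> normal_frames \<sigma>" and W: "W \<in> normal_frames \<sigma>" and eq: "colspan U = colspan W"
  have sel: "(A *v x) $ \<sigma> i = x $ i" if "A \<in> normal_frames \<sigma>" for A :: "real^'r^'n" and x i
    using that by (simp add: normal_frames_def matrix_vector_mult_def if_distrib
        [where f = "\<lambda>c. c * _"] cong: if_cong)
  have "U *v x = W *v x" for x
  proof -
    obtain z where z: "U *v x = W *v z"
      using eq unfolding colspan_range by (metis rangeE rangeI)
    then have "x = z"
      using sel[OF U] sel[OF W] by (metis vec_eq_iff)
    with z show ?thesis by simp
  qed
  then show "U = W"
    by (simp add: matrix_eq)
qed

end

theory Submission
  imports Defs
begin

text \<open>
  Write \<open>\<rho> i\<close> for the norm of row \<open>i\<close> of an orthonormal frame of a subspace \<open>V\<close>. Since the squares of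
  the \<open>\<rho> i\<close> add up to \<open>r\<close>, the penalty of \<open>V\<close> is the sum of the \<open>\<rho> i * (1 - \<rho> i)\<close> (\<open>R12_eq_sum\<close>).
  It is nonnegative, and it vanishes only if all row norms are \<open>0\<close> or \<open>1\<close>, that is, only on the
  finitely many coordinate subspaces (\<open>R12_zero_imp_coordinate_subspace\<close>).
  
  The first half of the theorem follows from nonnegativity, semicontinuity and compactness. A
  minimizer of the penalized function is at least as good as the given point of penalty zero, so it
  lies in the sublevel set of \<open>M\<close>; conversely, the lower semicontinuous penalized function attains a
  minimum on this compact set, and that minimum is global because the values elsewhere exceed \<open>M\<close>.
  
  The second half is local on the sublevel set: by compactness (\<open>compactin_uniform_bound\<close>) it is
  enough that each of its points has a neighbourhood with its own threshold. Where the penalty is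
  positive, it is bounded below nearby, and a large weight would push the value of a minimizer above
  \<open>M\<close>. The interesting case is a point whose subspace \<open>V\<^sub>0\<close> is a coordinate subspace. There
  the penalty has a kink: in the standard chart centred at \<open>V\<^sub>0\<close>, it is at least a constant times the
  \<open>\<ell>\<^sub>1\<close> norm of the coordinates (\<open>R12_sharp\<close>). The objective, being continuously differentiable, changes by
  at most a constant times the same norm when the subspace moves to \<open>V\<^sub>0\<close> and the point of the
  other manifold stays fixed (\<open>lipschitz_from_partial_derivs\<close>). Hence for large weights this move
  strictly decreases the penalized function unless the penalty is already zero
  (\<open>penalty_dominates_locally\<close>).
\<close>

section \<open>The penalty in terms of row norms\<close>

text \<open>
  The squared row norms of an orthonormal frame sum to its number of columns. Replacing that number
  by this sum turns the penalty into a sum of terms \<open>\<rho> (1 - \<rho>)\<close>, each nonnegative because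
  row norms lie in \<open>[0, 1]\<close>, and each zero only for \<open>\<rho> \<in> {0, 1}\<close>.
\<close>

lemma R12_eq_sum:
  fixes U :: "real^'r^'n"
  assumes "orthonormal_frame V U"
  shows "R12 TYPE('r) V = (\<Sum>i\<in>UNIV. norm (row i U) * (1 - norm (row i U)))"
proof -
  have U: "transpose U ** U = mat 1"
    using assms by (simp add: orthonormal_frame_def)
  have col: "(\<Sum>i\<in>UNIV. U $ i $ j * U $ i $ j) = 1" for j
  proof -
    have "(transpose U ** U) $ j $ j = 1"
      by (simp add: U mat_def)
    then show ?thesis
      by (simp add: matrix_matrix_mult_def transpose_def)
  qed
  have "(\<Sum>i\<in>UNIV. (norm (row i U))\<^sup>2) = (\<Sum>i\<in>UNIV. \<Sum>j\<in>UNIV. U $ i $ j * U $ i $ j)"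
    by (simp add: power2_norm_eq_inner inner_vec_def row_def)
  also have "\<dots> = (\<Sum>j\<in>UNIV. \<Sum>i\<in>UNIV. U $ i $ j * U $ i $ j)"
    by (rule sum.swap)
  also have "\<dots> = real CARD('r)"
    by (simp add: col)
  finally show ?thesis
    by (simp add: R12_eq[OF assms] norm12_def algebra_simps sum_subtractf power2_eq_square)
qed

lemma orthonormal_frame_norm:
  fixes U :: "real^'r^'n"
  assumes "orthonormal_frame V U"
  shows "norm (U *v z) = norm z"
proof -
  have "(U *v z) \<bullet> (U *v z) = (transpose U *v (U *v z)) \<bullet> z"
    by (simp add: dot_lmul_matrix[symmetric] vector_transpose_matrix flip: transpose_matrix_vector)
  also have "\<dots> = z \<bullet> z"
    using assms by (simp add: orthonormal_frame_def matrix_vector_mul_assoc)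
  finally show ?thesis
    by (simp add: norm_eq_sqrt_inner)
qed

lemma matrix_vector_nth: "(U *v z) $ i = row i U \<bullet> z" for U :: "real^'r^'n"
  by (simp add: matrix_vector_mult_def row_def inner_vec_def)

text \<open>
  Together with the next lemma, this characterizes the norm of row \<open>i\<close> as the maximum of
  \<open>v $ i\<close> over unit vectors \<open>v\<close> of the subspace (unless the row is zero). Estimates of row norms
  can therefore be made inside the subspace, without an explicit orthonormal frame.
\<close>

lemma abs_coordinate_le_row_norm:
  fixes U :: "real^'r^'n"
  assumes "orthonormal_frame V U" "v \<in> V"
  shows "\<bar>v $ i\<bar> \<le> norm (row i U) * norm v"
proof -
  obtain z where z: "v = U *v z"
    using assms by (auto simp: orthonormal_frame_def colspan_range)
  then show ?thesis
    using Cauchy_Schwarz_ineq2[of "row i U" z] orthonormal_frame_norm[OF assms(1)]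
    by (simp add: matrix_vector_nth)
qed

lemma row_norm_attained:
  fixes U :: "real^'r^'n"
  assumes "orthonormal_frame V U"
  obtains v where "v \<in> V" "norm v = norm (row i U)" "v $ i = (norm (row i U))\<^sup>2"
proof
  show "U *v row i U \<in> V"
    using assms by (auto simp: orthonormal_frame_def colspan_range)
  show "norm (U *v row i U) = norm (row i U)"
    by (rule orthonormal_frame_norm[OF assms])
  show "(U *v row i U) $ i = (norm (row i U))\<^sup>2"
    by (simp add: matrix_vector_nth power2_norm_eq_inner)
qed

lemma row_norm_le_1:
  fixes U :: "real^'r^'n"
  assumes "orthonormal_frame V U"
  shows "norm (row i U) \<le> 1"
proof -
  obtain v where "norm v = norm (row i U)" "v $ i = (norm (row i U))\<^sup>2"
    using row_norm_attained[OF assms] .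
  then have "(norm (row i U))\<^sup>2 \<le> norm (row i U)"
    by (metis abs_ge_self component_le_norm_cart order_trans)
  then show ?thesis
    by (metis mult_le_cancel_left2 norm_ge_zero not_less power2_eq_square order.order_iff_strict
        mult_le_cancel_left1 zero_le_one)
qed

lemma R12_nonneg:
  assumes "V \<in> grassmannian TYPE('r::finite)"
  shows "R12 TYPE('r) (V :: (real^'n) set) \<ge> 0"
proof -
  obtain U :: "real^'r^'n" where U: "orthonormal_frame V U"
    using ex_orthonormal_frame[OF assms] by blast
  show ?thesis
    unfolding R12_eq_sum[OF U] using row_norm_le_1[OF U] by (intro sum_nonneg mult_nonneg_nonneg) auto
qed

lemma colspan_mult_subset: "colspan (A ** S) \<subseteq> colspan A"
  for A :: "real^'r^'n" and S :: "real^'r^'r"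
  unfolding colspan_range by (auto simp flip: matrix_vector_mul_assoc)

text \<open>
  Right multiplication can only shrink the column space, and full rank leaves no room to shrink.
\<close>

lemma colspan_mult_full_rank:
  fixes A :: "real^'r^'n" and S :: "real^'r^'r"
  assumes "A ** S \<in> full_rank"
  shows "colspan (A ** S) = colspan A"
proof (rule subspace_dim_equal)
  have "dim (colspan A) \<le> CARD('r)"
    using rank_bound[of A] by (simp add: colspan_def column_rank_def)
  then show "dim (colspan A) \<le> dim (colspan (A ** S))"
    using assms by (simp add: full_rank_def colspan_def column_rank_def)
qed (use colspan_mult_subset in \<open>auto simp: colspan_def\<close>)

definition coordinate_frame :: "('r::finite \<Rightarrow> 'n::finite) \<Rightarrow> real^'r^'n"
  where "coordinate_frame \<sigma> = (\<chi> i j. if i = \<sigma> j then 1 else 0)"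

lemma coordinate_frame_normal: "inj \<sigma> \<Longrightarrow> coordinate_frame \<sigma> \<in> normal_frames \<sigma>"
  by (auto simp: coordinate_frame_def normal_frames_def inj_eq)

text \<open>
  If the penalty vanishes, every row norm is \<open>0\<close> or \<open>1\<close>. As the row norms then add up to the number
  of columns, exactly that many rows are nonzero; these rows form a square block \<open>T\<close>, and the frame
  is \<open>coordinate_frame \<sigma> ** T\<close>.
\<close>

lemma R12_zero_imp_coordinate_subspace:
  fixes V :: "(real^'n) set"
  assumes "V \<in> grassmannian TYPE('r::finite)" "R12 TYPE('r) V = 0"
  obtains \<sigma> :: "'r::finite \<Rightarrow> 'n" where "inj \<sigma>" "V = colspan (coordinate_frame \<sigma>)"
proof -
  obtain U :: "real^'r^'n" where U: "orthonormal_frame V U"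
    using ex_orthonormal_frame[OF assms(1)] by blast
  define I where "I = {i. norm (row i U) = 1}"
  have "norm (row i U) * (1 - norm (row i U)) = 0" for i
    using assms(2) row_norm_le_1[OF U] unfolding R12_eq_sum[OF U]
    by (subst (asm) sum_nonneg_eq_0_iff) auto
  then have row: "norm (row i U) = (if i \<in> I then 1 else 0)" for i
    by (auto simp: I_def)
  have "norm12 U = real CARD('r)"
    using R12_eq[OF U] assms(2) by simp
  moreover have "norm12 U = real (card I)"
    by (simp add: norm12_def row sum.If_cases)
  ultimately have "card I = CARD('r)" by simp
  then obtain \<sigma> where \<sigma>: "bij_betw \<sigma> (UNIV :: 'r set) I"
    using finite_same_card_bij[of "UNIV :: 'r set" I] by auto
  then have inj: "inj \<sigma>" and ran: "range \<sigma> = I"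
    by (auto simp: bij_betw_def)
  define T :: "real^'r^'r" where "T = (\<chi> i. U $ \<sigma> i)"
  have zero: "U $ i $ j = 0" if "i \<notin> range \<sigma>" for i j
    using row[of i] that by (simp add: ran row_def vec_eq_iff)
  have UT: "U = coordinate_frame \<sigma> ** T"
  proof -
    have "(\<Sum>k\<in>UNIV. (if i = \<sigma> k then 1 else 0) * U $ \<sigma> k $ j) = U $ i $ j" for i j
    proof (cases "i \<in> range \<sigma>")
      case True
      then obtain l where "i = \<sigma> l" by blast
      then show ?thesis
        using inj by (simp add: inj_eq if_distrib[where f = "\<lambda>c. c * _"] cong: if_cong)
    next
      case False
      then have "i \<noteq> \<sigma> k" for k by blast
      then show ?thesis
        using zero[OF False] by simp
    qed
    then show ?thesis
      by (simp add: vec_eq_iff matrix_matrix_mult_def coordinate_frame_def T_def)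
  qed
  have V: "colspan U = V"
    using U by (simp add: orthonormal_frame_def)
  then have "U \<in> full_rank"
    using assms(1) by (simp flip: colspan_in_grassmannian_iff)
  then have "V = colspan (coordinate_frame \<sigma>)"
    using colspan_mult_full_rank UT V by metis
  with inj that show ?thesis by blast
qed

lemma normal_frame_mult_nth:
  fixes A :: "real^'r^'n"
  assumes "A \<in> normal_frames \<sigma>"
  shows "(A *v z) $ \<sigma> i = z $ i"
  using assms by (simp add: normal_frames_def matrix_vector_mult_def if_distrib
      [where f = "\<lambda>c. c * _"] cong: if_cong)

text \<open>
  The penalty grows at least linearly away from a coordinate subspace: this sharp growth is what
  makes the penalty exact. The reason is that \<open>\<rho> (1 - \<rho>) \<ge> \<rho> / 2\<close> as soon as \<open>\<rho> \<le> 1 / 2\<close>,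
  and that the norm \<open>\<rho>\<close> of an unselected row of an orthonormal frame is comparable with the entries
  of that row in the normal frame.
\<close>

lemma R12_sharp:
  fixes A :: "real^'r^'n"
  assumes A: "A \<in> normal_frames \<sigma>"
    and small: "\<And>i j. i \<notin> range \<sigma> \<Longrightarrow> \<bar>A $ i $ j\<bar> \<le> 1 / (2 * real CARD('r))"
  shows "(\<Sum>(i, j)\<in>(- range \<sigma>) \<times> UNIV. \<bar>A $ i $ j\<bar>)
    \<le> 2 * real CARD('n) * real CARD('r) * R12 TYPE('r) (colspan A)"
proof -
  define r n where "r = real CARD('r)" and "n = real CARD('n)"
  have pos: "r \<ge> 1" "n \<ge> 1"
    by (simp_all add: r_def n_def Suc_leI)
  have "colspan A \<in> grassmannian TYPE('r)"
    using A by (simp add: colspan_in_grassmannian_iff normal_frames_full_rank)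
  then obtain U :: "real^'r^'n" where U: "orthonormal_frame (colspan A) U"
    using ex_orthonormal_frame by blast
  define \<rho> where "\<rho> i = norm (row i U)" for i
  have \<rho>: "0 \<le> \<rho> i" "\<rho> i \<le> 1" for i
    using row_norm_le_1[OF U] by (simp_all add: \<rho>_def)
  have entry: "\<bar>A $ i $ j\<bar> \<le> 1" for i j
  proof (cases "i \<in> range \<sigma>")
    case True
    then show ?thesis
      using A by (auto simp: normal_frames_def)
  next
    case False
    have "1 / (2 * r) \<le> 1"
      using pos by (simp add: field_simps)
    with small[OF False, of j, folded r_def] show ?thesis
      by (metis order_trans)
  qed
  \<comment> \<open>The entry is a coordinate of a column of \<open>A\<close>, a vector of the subspace of norm at most \<open>n\<close>.\<close>
  have upper: "\<bar>A $ i $ j\<bar> \<le> n * \<rho> i" for i j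
  proof -
    have "norm (column j A) \<le> (\<Sum>i\<in>UNIV. \<bar>column j A $ i\<bar>)"
      by (rule norm_le_l1_cart)
    also have "\<dots> \<le> (\<Sum>i\<in>(UNIV :: 'n set). 1)"
      by (rule sum_mono) (simp add: column_def entry)
    finally have "norm (column j A) \<le> n"
      by (simp add: n_def)
    moreover have "column j A \<in> colspan A"
      by (auto simp: colspan_def columns_def intro: span_base)
    ultimately have "\<bar>column j A $ i\<bar> \<le> \<rho> i * n"
      using abs_coordinate_le_row_norm[OF U] \<rho>(1)
      by (metis \<rho>_def mult_left_mono order_trans)
    then show ?thesis
      by (simp add: column_def mult.commute)
  qed
  \<comment> \<open>The vector that attains \<open>\<rho> i\<close> has the form \<open>A *v z\<close>, where \<open>z\<close> consists of its selected
    coordinates, so row \<open>i\<close> of \<open>A\<close> being small forces its coordinate \<open>i\<close> to be small.\<close>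
  have half: "\<rho> i \<le> 1 / 2" if i: "i \<notin> range \<sigma>" for i
  proof -
    obtain v where v: "v \<in> colspan A" "norm v = \<rho> i" "v $ i = (\<rho> i)\<^sup>2"
      using row_norm_attained[OF U] unfolding \<rho>_def .
    then obtain z where z: "v = A *v z"
      by (auto simp: colspan_range)
    have "\<bar>z $ j\<bar> \<le> \<rho> i" for j
      using component_le_norm_cart[of v "\<sigma> j"] v(2) by (simp add: z normal_frame_mult_nth[OF A])
    then have "\<bar>A $ i $ j * z $ j\<bar> \<le> 1 / (2 * r) * \<rho> i" for j
      unfolding abs_mult using small[OF i, of j] pos by (intro mult_mono) (auto simp: r_def)
    then have "\<bar>v $ i\<bar> \<le> (\<Sum>j\<in>(UNIV :: 'r set). 1 / (2 * r) * \<rho> i)"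
      unfolding z matrix_vector_mult_def vec_lambda_beta by (intro order_trans[OF sum_abs] sum_mono)
    also have "\<dots> = \<rho> i / 2"
      using pos by (simp add: r_def)
    finally have "\<rho> i * \<rho> i \<le> \<rho> i * (1 / 2)"
      by (simp add: v(3) power2_eq_square)
    then show ?thesis
      using mult_strict_left_mono[of "1 / 2" "\<rho> i" "\<rho> i"] by (smt (verit) divide_pos_pos)
  qed
  have "(\<Sum>(i, j)\<in>(- range \<sigma>) \<times> (UNIV :: 'r set). \<bar>A $ i $ j\<bar>)
      = (\<Sum>i\<in>- range \<sigma>. \<Sum>j\<in>(UNIV :: 'r set). \<bar>A $ i $ j\<bar>)"
    by (simp add: sum.cartesian_product)
  also have "\<dots> \<le> (\<Sum>i\<in>- range \<sigma>. \<Sum>j\<in>(UNIV :: 'r set). 2 * n * (\<rho> i * (1 - \<rho> i)))"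
  proof (intro sum_mono)
    fix i :: 'n and j :: 'r assume "i \<in> - range \<sigma>"
    then have "\<rho> i \<le> 2 * (\<rho> i * (1 - \<rho> i))"
      using half[of i] \<rho>[of i] mult_left_mono[of "1 / 2" "1 - \<rho> i" "\<rho> i"] by simp
    then have "n * \<rho> i \<le> n * (2 * (\<rho> i * (1 - \<rho> i)))"
      using pos by (intro mult_left_mono) auto
    with upper[of i j] show "\<bar>A $ i $ j\<bar> \<le> 2 * n * (\<rho> i * (1 - \<rho> i))"
      by simp
  qed
  also have "\<dots> = 2 * n * r * (\<Sum>i\<in>- range \<sigma>. \<rho> i * (1 - \<rho> i))"
    by (simp add: r_def sum_distrib_left mult_ac)
  also have "\<dots> \<le> 2 * n * r * (\<Sum>i\<in>UNIV. \<rho> i * (1 - \<rho> i))"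
    using pos \<rho> by (intro mult_left_mono sum_mono2) auto
  finally show ?thesis
    by (simp add: R12_eq_sum[OF U] \<rho>_def n_def r_def)
qed

text \<open>
  Row norms are maxima of quotients that depend continuously on an arbitrary spanning matrix, and a
  maximum of continuous functions is lower semicontinuous. Semicontinuity serves both purposes that
  continuity of the penalty would: existence of minimizers, and a local lower bound where the penalty
  is positive.
\<close>

lemma R12_lower_semicontinuous:
  fixes V :: "(real^'n) set"
  assumes V: "V \<in> grassmannian TYPE('r::finite)" and c: "c < R12 TYPE('r) V"
  obtains W where "openin (grassmann_topology TYPE('r)) W" "V \<in> W"
    "\<And>V'. V' \<in> W \<Longrightarrow> c < R12 TYPE('r) V'"
proof
  define W where "W = {V' \<in> grassmannian TYPE('r). c < R12 TYPE('r) (V' :: (real^'n) set)}"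
  show "V \<in> W"
    using assms by (simp add: W_def)
  show "c < R12 TYPE('r) V'" if "V' \<in> W" for V'
    using that by (simp add: W_def)
  have "openin (top_of_set full_rank) {U::real^'r^'n. U \<in> full_rank \<and> colspan U \<in> W}"
  proof (subst openin_subopen, intro ballI)
    fix U\<^sub>0 :: "real^'r^'n"
    assume "U\<^sub>0 \<in> {U. U \<in> full_rank \<and> colspan U \<in> W}"
    then have U0: "U\<^sub>0 \<in> full_rank" "colspan U\<^sub>0 \<in> grassmannian TYPE('r)" "c < R12 TYPE('r) (colspan U\<^sub>0)"
      by (auto simp: W_def)
    obtain P :: "real^'r^'n" where P: "orthonormal_frame (colspan U\<^sub>0) P"
      using ex_orthonormal_frame[OF U0(2)] by blast
    have "\<exists>z. norm (U\<^sub>0 *v z) = norm (row i P) \<and> (U\<^sub>0 *v z) $ i = (norm (row i P))\<^sup>2" for i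
      using row_norm_attained[OF P, of i] unfolding colspan_range by (metis rangeE)
    then obtain z where z: "\<And>i. norm (U\<^sub>0 *v z i) = norm (row i P)"
      "\<And>i. (U\<^sub>0 *v z i) $ i = (norm (row i P))\<^sup>2"
      by metis
    \<comment> \<open>Keep the maximizers \<open>z i\<close> that belong to \<open>U\<^sub>0\<close> for nearby \<open>U\<close> as well: then \<open>G\<close> is a
      continuous lower bound of the penalty that is exact at \<open>U\<^sub>0\<close>.\<close>
    define g where "g i U = (U *v z i) $ i / norm (U *v z i)" for i and U :: "real^'r^'n"
    define G where "G U = (\<Sum>i\<in>UNIV. g i U) - real CARD('r)" for U
    have inj: "U *v y = 0 \<longleftrightarrow> y = 0" if "U \<in> full_rank" for U :: "real^'r^'n" and y
    proof -
      have "inj ((*v) U)"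
        using that full_rank_injective[of U] by (simp add: full_rank_def)
      from inj_eq[OF this, of y 0] show ?thesis by simp
    qed
    have contG: "continuous_on full_rank G"
    proof -
      have "continuous_on full_rank (g i)" for i
      proof (cases "z i = 0")
        case True
        then show ?thesis by (simp add: g_def)
      next
        case False
        have lin: "bounded_linear (\<lambda>U::real^'r^'n. U *v z i)"
          by (rule linear_conv_bounded_linear[THEN iffD1], rule linearI)
            (auto simp: vec_eq_iff matrix_vector_mult_def algebra_simps sum.distrib sum_distrib_left)
        show ?thesis
          unfolding g_def using False inj
          by (intro continuous_intros linear_continuous_on lin) auto
      qed
      then show ?thesis
        unfolding G_def by (intro continuous_intros)
    qed
    have lower: "G U \<le> R12 TYPE('r) (colspan U)" if "U \<in> full_rank" for U
    proof -
      have "colspan U \<in> grassmannian TYPE('r)"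
        using that by (simp add: colspan_in_grassmannian_iff)
      then obtain Q :: "real^'r^'n" where Q: "orthonormal_frame (colspan U) Q"
        using ex_orthonormal_frame by blast
      have "g i U \<le> norm (row i Q)" for i
      proof (cases "U *v z i = 0")
        case True
        then show ?thesis by (simp add: g_def)
      next
        case False
        then show ?thesis
          using abs_coordinate_le_row_norm[OF Q, of "U *v z i" i]
          by (auto simp: g_def colspan_range divide_le_eq)
      qed
      then show ?thesis
        by (simp add: G_def R12_eq[OF Q] norm12_def sum_mono)
    qed
    have "g i U\<^sub>0 = norm (row i P)" for i
      by (simp add: g_def z power2_eq_square)
    then have eq: "G U\<^sub>0 = R12 TYPE('r) (colspan U\<^sub>0)"
      by (simp add: G_def R12_eq[OF P] norm12_def)
    let ?T = "full_rank \<inter> G -` {c<..}"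
    have "openin (top_of_set full_rank) ?T"
      using contG by (auto intro: continuous_openin_preimage_gen)
    moreover have "U\<^sub>0 \<in> ?T"
      using U0 eq by simp
    moreover have "?T \<subseteq> {U. U \<in> full_rank \<and> colspan U \<in> W}"
      using lower by (force simp: W_def colspan_in_grassmannian_iff)
    ultimately show "\<exists>T. openin (top_of_set full_rank) T \<and> U\<^sub>0 \<in> T \<and> T \<subseteq> {U. U \<in> full_rank \<and> colspan U \<in> W}"
      by blast
  qed
  then show "openin (grassmann_topology TYPE('r)) W"
    by (auto simp: openin_grassmann_topology grassmann_open_def W_def)
qed

section \<open>The standard charts of the Grassmannian\<close>

definition selected_rows :: "('r \<Rightarrow> 'n) \<Rightarrow> real^'r^'n \<Rightarrow> real^'r^'r"
  where "selected_rows \<sigma> U = (\<chi> p. U $ \<sigma> p)"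

lemma continuous_on_det:
  fixes A :: "'a::topological_space \<Rightarrow> real^'r^'r"
  assumes "\<And>p q. continuous_on S (\<lambda>x. A x $ p $ q)"
  shows "continuous_on S (\<lambda>x. det (A x))"
  unfolding det_def by (intro continuous_intros assms)

text \<open>
  This is \<open>U\<close> times the inverse of its selected block, with the inverse written out by Cramer's rule:
  in this form continuity in \<open>U\<close> is evident.
\<close>

definition normalized :: "('r::finite \<Rightarrow> 'n::finite) \<Rightarrow> real^'r^'n \<Rightarrow> real^'r^'n"
  where "normalized \<sigma> U = (\<chi> i k.
    det (\<chi> p q. if q = k then U $ i $ p else U $ \<sigma> q $ p) / det (transpose (selected_rows \<sigma> U)))"

lemma normalized_mult:
  fixes U :: "real^'r::finite^'n::finite"
  assumes "det (selected_rows \<sigma> U) \<noteq> 0"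
  shows "normalized \<sigma> U ** selected_rows \<sigma> U = U"
    and "normalized \<sigma> U \<in> normal_frames \<sigma>"
proof -
  let ?A = "transpose (selected_rows \<sigma> U)"
  have det: "det ?A \<noteq> 0"
    using assms by (simp add: det_transpose)
  have nth: "?A $ p $ q = U $ \<sigma> q $ p" for p q
    by (simp add: transpose_def selected_rows_def)
  have row: "?A *v x = U $ i \<longleftrightarrow> x = normalized \<sigma> U $ i" for x i
    unfolding cramer[OF det] by (simp add: normalized_def nth cong: if_cong)
  show "normalized \<sigma> U ** selected_rows \<sigma> U = U"
  proof -
    have "(normalized \<sigma> U ** selected_rows \<sigma> U) $ i $ j = (?A *v (normalized \<sigma> U $ i)) $ j" for i j
      by (simp add: matrix_matrix_mult_def matrix_vector_mult_def transpose_def mult.commute)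
    then show ?thesis
      using row by (simp add: vec_eq_iff)
  qed
  have "normalized \<sigma> U $ \<sigma> l = axis l 1" for l
  proof -
    have "?A *v axis l 1 = U $ \<sigma> l"
      by (simp add: matrix_vector_mult_basis vec_eq_iff column_def nth)
    with row show ?thesis by metis
  qed
  then show "normalized \<sigma> U \<in> normal_frames \<sigma>"
    by (auto simp: normal_frames_def axis_def)
qed

text \<open>
  Nonvanishing of a minor is an open condition, so this makes the chart domains open.
\<close>

lemma normal_frame_chart_iff:
  fixes U :: "real^'r::finite^'n::finite"
  assumes "U \<in> full_rank"
  shows "colspan U \<in> colspan ` (normal_frames \<sigma> :: (real^'r^'n) set) \<longleftrightarrow> det (selected_rows \<sigma> U) \<noteq> 0"
proof
  assume "det (selected_rows \<sigma> U) \<noteq> 0"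
  then have "normalized \<sigma> U \<in> normal_frames \<sigma>" "colspan U = colspan (normalized \<sigma> U)"
    using normalized_mult colspan_mult_full_rank assms by metis+
  then show "colspan U \<in> colspan ` (normal_frames \<sigma> :: (real^'r^'n) set)"
    by blast
next
  assume "colspan U \<in> colspan ` (normal_frames \<sigma> :: (real^'r^'n) set)"
  then obtain A :: "real^'r^'n" where A: "A \<in> normal_frames \<sigma>" "colspan U = colspan A"
    by blast
  have "\<exists>t. A *v axis j 1 = U *v t" for j
    using A(2) unfolding colspan_range by (metis rangeE rangeI)
  then obtain t where t: "\<And>j. A *v axis j 1 = U *v t j"
    by metis
  have "selected_rows \<sigma> U ** (\<chi> p j. t j $ p) = mat 1"
  proof -
    have "(selected_rows \<sigma> U ** (\<chi> p j. t j $ p)) $ i $ j = (U *v t j) $ \<sigma> i" for i j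
      by (simp add: matrix_matrix_mult_def matrix_vector_mult_def selected_rows_def)
    also have "(U *v t j) $ \<sigma> i = axis j 1 $ i" for i j
      by (simp add: normal_frame_mult_nth[OF A(1)] flip: t)
    finally show ?thesis
      by (simp add: vec_eq_iff mat_def axis_def)
  qed
  then have "det (selected_rows \<sigma> U) * det (\<chi> p j. t j $ p) = 1"
    by (metis det_I det_mul)
  then show "det (selected_rows \<sigma> U) \<noteq> 0"
    by auto
qed

text \<open>
  A matrix of full column rank has a basis of its row space among its rows.
\<close>

lemma grassmannian_chart_cover:
  fixes V :: "(real^'n::finite) set"
  assumes "V \<in> grassmannian TYPE('r::finite)"
  obtains \<sigma> :: "'r::finite \<Rightarrow> 'n" where "inj \<sigma>" "V \<in> colspan ` (normal_frames \<sigma> :: (real^'r^'n) set)"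
proof -
  obtain U :: "real^'r^'n" where "orthonormal_frame V U"
    using ex_orthonormal_frame[OF assms] by blast
  then have V: "V = colspan U" and U: "U \<in> full_rank"
    using assms by (auto simp: orthonormal_frame_def simp flip: colspan_in_grassmannian_iff)
  obtain B where B: "B \<subseteq> rows U" "independent B" "card B = dim (rows U)"
    using basis_exists[of "rows U"] by metis
  have "card B = CARD('r)"
    using U B(3) by (simp add: full_rank_def row_rank_def)
  moreover have "finite B"
    using B(2) independent_imp_finite by blast
  ultimately obtain b where b: "bij_betw b (UNIV :: 'r set) B"
    using finite_same_card_bij[of "UNIV :: 'r set" B] by auto
  have "\<exists>i. b p = U $ i" for p
    using b B(1) by (auto simp: bij_betw_def rows_def row_def)
  then obtain \<sigma> where \<sigma>: "\<And>p. b p = U $ \<sigma> p"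
    by metis
  have "inj \<sigma>"
    using b \<sigma> unfolding bij_betw_def by (metis injI inj_eq)
  moreover have "det (selected_rows \<sigma> U) \<noteq> 0"
  proof -
    have "rows (selected_rows \<sigma> U) = B"
      using b by (auto simp: rows_def row_def selected_rows_def \<sigma> bij_betw_def image_def)
    then have "rank (selected_rows \<sigma> U) = CARD('r)"
      using \<open>card B = CARD('r)\<close> B(2) by (simp add: row_rank_def dim_eq_card_independent)
    then show ?thesis
      by (simp add: det_eq_0_rank)
  qed
  ultimately show ?thesis
    using that normal_frame_chart_iff[OF U] V by blast
qed

lemma openin_grassmann_chart:
  "openin (grassmann_topology TYPE('r::finite))
     (colspan ` (normal_frames \<sigma> :: (real^'r^'n::finite) set))"
proof -
  have "continuous_on full_rank (\<lambda>U::real^'r^'n. det (selected_rows \<sigma> U))"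
    by (intro continuous_on_det) (simp add: selected_rows_def continuous_intros)
  then have "openin (top_of_set full_rank)
      (full_rank \<inter> (\<lambda>U::real^'r^'n. det (selected_rows \<sigma> U)) -` (- {0}))"
    by (rule continuous_openin_preimage_gen) auto
  also have "full_rank \<inter> (\<lambda>U::real^'r^'n. det (selected_rows \<sigma> U)) -` (- {0}) =
      {U::real^'r^'n. U \<in> full_rank \<and> colspan U \<in> colspan ` (normal_frames \<sigma> :: (real^'r^'n) set)}"
    using normal_frame_chart_iff by auto
  finally show ?thesis
    using normal_frames_full_rank
    by (auto simp: openin_grassmann_topology grassmann_open_def colspan_in_grassmannian_iff)
qed

definition normal_frame_of :: "('r::finite \<Rightarrow> 'n::finite) \<Rightarrow> (real^'n) set \<Rightarrow> real^'r^'n"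
  where "normal_frame_of \<sigma> V = (THE U. U \<in> normal_frames \<sigma> \<and> colspan U = V)"

lemma normal_frame_of_colspan:
  "A \<in> normal_frames \<sigma> \<Longrightarrow> normal_frame_of \<sigma> (colspan A) = A"
  unfolding normal_frame_of_def
  using inj_on_colspan_normal_frames by (intro the_equality) (auto dest: inj_onD)

text \<open>
  By the quotient topology it suffices to see that the normal frame depends continuously on a
  spanning matrix, where it is given by the normalization.
\<close>

lemma continuous_map_normal_frame_of:
  "continuous_map (subtopology (grassmann_topology TYPE('r::finite))
      (colspan ` (normal_frames \<sigma> :: (real^'r^'n::finite) set)))
    euclidean (normal_frame_of \<sigma>)"
proof -
  let ?V = "colspan ` (normal_frames \<sigma> :: (real^'r^'n) set)"
  let ?U = "{U::real^'r^'n. U \<in> full_rank \<and> colspan U \<in> ?V}"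
  have quo: "quotient_map (subtopology (top_of_set full_rank) ?U)
      (subtopology (grassmann_topology TYPE('r)) ?V) colspan"
    by (rule quotient_map_restriction[OF quotient_map_colspan]) (auto simp: openin_grassmann_chart)
  have top: "subtopology (top_of_set full_rank) ?U = top_of_set ?U"
    by (simp add: subtopology_subtopology Int_absorb1 Collect_mono_iff inf.absorb2 subset_eq)
  have "continuous_on ?U (normal_frame_of \<sigma> \<circ> colspan)"
  proof (rule continuous_on_eq)
    show "continuous_on ?U (normalized \<sigma>)"
      unfolding normalized_def
    proof (intro continuous_on_vec_lambda continuous_on_divide continuous_on_det ballI)
      fix i :: 'n and k p q :: 'r
      show "continuous_on ?U (\<lambda>U. (\<chi> p q. if q = k then U $ i $ p else U $ \<sigma> q $ p) $ p $ q)"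
        by (cases "q = k") (auto intro!: continuous_intros)
      show "continuous_on ?U (\<lambda>U. transpose (selected_rows \<sigma> U) $ p $ q)"
        by (simp add: transpose_def selected_rows_def continuous_intros)
      show "det (transpose (selected_rows \<sigma> U)) \<noteq> 0" if "U \<in> ?U" for U
        using that normal_frame_chart_iff by (auto simp: det_transpose)
    qed
    show "normalized \<sigma> U = (normal_frame_of \<sigma> \<circ> colspan) U" if "U \<in> ?U" for U
    proof -
      have U: "U \<in> full_rank" "det (selected_rows \<sigma> U) \<noteq> 0"
        using that normal_frame_chart_iff by auto
      then have "normalized \<sigma> U \<in> normal_frames \<sigma>" "colspan U = colspan (normalized \<sigma> U)"
        using normalized_mult colspan_mult_full_rank by metis+
      then show ?thesis
        by (simp add: normal_frame_of_colspan)
    qed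
  qed
  then have "continuous_map (subtopology (top_of_set full_rank) ?U) euclidean (normal_frame_of \<sigma> \<circ> colspan)"
    by (simp only: top continuous_map_iff_continuous)
  then show ?thesis
    by (rule continuous_compose_quotient_map[OF quo])
qed

text \<open>
  This is continuity of the inverse of the chart at its centre, stated with boxes because the
  comparison with the centre moves one coordinate at a time.
\<close>

lemma colspan_box_in_open:
  assumes W: "openin (grassmann_topology TYPE('r::finite)) W"
    and \<sigma>: "inj \<sigma>" "colspan (coordinate_frame \<sigma> :: real^'r^'n::finite) \<in> W"
  obtains \<delta> where "\<delta> > 0"
    "\<And>A :: real^'r^'n. \<lbrakk>A \<in> normal_frames \<sigma>; \<And>i j. i \<notin> range \<sigma> \<Longrightarrow> \<bar>A $ i $ j\<bar> < \<delta>\<rbrakk> \<Longrightarrow> colspan A \<in> W"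
proof -
  let ?E = "coordinate_frame \<sigma> :: real^'r^'n"
  have E: "?E \<in> normal_frames \<sigma>"
    by (rule coordinate_frame_normal[OF \<sigma>(1)])
  have "openin (top_of_set full_rank) {U::real^'r^'n. U \<in> full_rank \<and> colspan U \<in> W}"
    using W by (simp add: openin_grassmann_topology grassmann_open_def)
  moreover have "?E \<in> {U. U \<in> full_rank \<and> colspan U \<in> W}"
    using \<sigma>(2) E normal_frames_full_rank by auto
  ultimately obtain \<epsilon> where \<epsilon>: "\<epsilon> > 0"
    "\<And>U. U \<in> full_rank \<Longrightarrow> dist U ?E < \<epsilon> \<Longrightarrow> colspan U \<in> W"
    unfolding openin_euclidean_subtopology_iff by blast
  define \<delta> where "\<delta> = \<epsilon> / (real CARD('n) * real CARD('r))"
  have "\<delta> > 0"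
    using \<epsilon>(1) by (simp add: \<delta>_def)
  moreover have "colspan A \<in> W"
    if A: "A \<in> normal_frames \<sigma>" and small: "\<And>i j. i \<notin> range \<sigma> \<Longrightarrow> \<bar>A $ i $ j\<bar> < \<delta>" for A :: "real^'r^'n"
  proof (rule \<epsilon>(2))
    show "A \<in> full_rank"
      by (rule normal_frames_full_rank[OF A])
    have entry: "\<bar>(A - ?E) $ i $ j\<bar> < \<delta>" for i j
    proof (cases "i \<in> range \<sigma>")
      case True
      then show ?thesis
        using A E \<open>\<delta> > 0\<close> by (auto simp: normal_frames_def)
    next
      case False
      then have "?E $ i $ j = 0"
        by (auto simp: coordinate_frame_def)
      with small[OF False] show ?thesis by simp
    qed
    have "dist A ?E \<le> (\<Sum>i\<in>UNIV. norm ((A - ?E) $ i))"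
      by (simp add: dist_norm norm_vec_def L2_set_le_sum del: vector_minus_component)
    also have "\<dots> \<le> (\<Sum>i\<in>UNIV. \<Sum>j\<in>UNIV. \<bar>(A - ?E) $ i $ j\<bar>)"
      by (intro sum_mono norm_le_l1_cart)
    also have "\<dots> < (\<Sum>i\<in>(UNIV :: 'n set). \<Sum>j\<in>(UNIV :: 'r set). \<delta>)"
      by (intro sum_strict_mono entry) auto
    also have "\<dots> = \<epsilon>"
      by (simp add: \<delta>_def)
    finally show "dist A ?E < \<epsilon>" .
  qed
  ultimately show ?thesis
    using that by blast
qed

text \<open>
  The inverse of the chart: \<open>grassmann_coords\<close> reads off the entries in the order \<open>e\<close>, and
  \<open>frame_with\<close> puts them back.
\<close>

definition frame_with :: "('r::finite \<Rightarrow> 'n::finite) \<Rightarrow> (nat \<Rightarrow> 'n \<times> 'r) \<Rightarrow> (nat \<Rightarrow> real) \<Rightarrow> real^'r^'n"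
  where "frame_with \<sigma> e b = (\<chi> i j. if i \<in> range \<sigma> then (if i = \<sigma> j then 1 else 0)
    else b (inv_into {..<grassmannian_dim TYPE('r) TYPE('n)} e (i, j)))"

lemma frame_with_normal: "inj \<sigma> \<Longrightarrow> frame_with \<sigma> e b \<in> normal_frames \<sigma>"
  by (auto simp: frame_with_def normal_frames_def inj_eq)

lemma grassmann_coords_colspan:
  fixes A :: "real^'r::finite^'n::finite"
  assumes "A \<in> normal_frames \<sigma>"
  shows "grassmann_coords \<sigma> e (colspan A) k =
    (if k < grassmannian_dim TYPE('r) TYPE('n) then A $ fst (e k) $ snd (e k) else 0)"
  using normal_frame_of_colspan[OF assms] by (simp add: grassmann_coords_def normal_frame_of_def)

lemma grassmann_coords_frame_with:
  fixes \<sigma> :: "'r::finite \<Rightarrow> 'n::finite"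
  assumes \<sigma>: "inj \<sigma>"
    and e: "bij_betw e {..<grassmannian_dim TYPE('r) TYPE('n)} ((- range \<sigma>) \<times> UNIV)"
    and b: "\<And>k. k \<ge> grassmannian_dim TYPE('r) TYPE('n) \<Longrightarrow> b k = 0"
  shows "grassmann_coords \<sigma> e (colspan (frame_with \<sigma> e b)) = b"
proof
  fix k
  show "grassmann_coords \<sigma> e (colspan (frame_with \<sigma> e b)) k = b k"
  proof (cases "k < grassmannian_dim TYPE('r) TYPE('n)")
    case True
    then have "e k \<in> (- range \<sigma>) \<times> UNIV"
      using bij_betwE[OF e] by blast
    then have "fst (e k) \<notin> range \<sigma>"
      by (simp add: mem_Times_iff)
    then show ?thesis
      unfolding grassmann_coords_colspan[OF frame_with_normal[OF \<sigma>]]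
      using True e by (simp add: frame_with_def bij_betw_def)
  next
    case False
    then show ?thesis
      using b by (simp add: grassmann_coords_colspan[OF frame_with_normal[OF \<sigma>]])
  qed
qed

lemma frame_with_coords:
  fixes A :: "real^'r::finite^'n::finite"
  assumes A: "A \<in> normal_frames \<sigma>"
    and e: "bij_betw e {..<grassmannian_dim TYPE('r) TYPE('n)} ((- range \<sigma>) \<times> UNIV)"
  shows "frame_with \<sigma> e (grassmann_coords \<sigma> e (colspan A)) = A"
proof -
  let ?N = "{..<grassmannian_dim TYPE('r) TYPE('n)}"
  have "frame_with \<sigma> e (grassmann_coords \<sigma> e (colspan A)) $ i $ j = A $ i $ j" for i j
  proof (cases "i \<in> range \<sigma>")
    case True
    then show ?thesis
      using A by (auto simp: frame_with_def normal_frames_def)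
  next
    case False
    then have "(i, j) \<in> e ` ?N"
      using e by (auto simp: bij_betw_def)
    then have "e (inv_into ?N e (i, j)) = (i, j)" "inv_into ?N e (i, j) \<in> ?N"
      by (rule f_inv_into_f, rule inv_into_into)
    with False show ?thesis
      by (simp add: frame_with_def grassmann_coords_colspan[OF A])
  qed
  then show ?thesis
    by (simp add: vec_eq_iff)
qed

lemma ex_entry_enumeration:
  fixes \<sigma> :: "'r::finite \<Rightarrow> 'n::finite"
  assumes "inj \<sigma>"
  obtains e where "bij_betw e {..<grassmannian_dim TYPE('r) TYPE('n)} ((- range \<sigma>) \<times> (UNIV :: 'r set))"
proof -
  have "card ((- range \<sigma>) \<times> (UNIV :: 'r set)) = grassmannian_dim TYPE('r) TYPE('n)"
    using assms by (simp add: card_cartesian_product grassmannian_dim_def Compl_eq_Diff_UNIV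
        card_Diff_subset card_image)
  then show ?thesis
    using that finite_same_card_bij[of "{..<grassmannian_dim TYPE('r) TYPE('n)}"
        "(- range \<sigma>) \<times> (UNIV :: 'r set)"] by auto
qed

lemma continuous_map_grassmann_coords:
  fixes \<sigma> :: "'r::finite \<Rightarrow> 'n::finite"
  shows "continuous_map (subtopology (grassmann_topology TYPE('r))
      (colspan ` (normal_frames \<sigma> :: (real^'r^'n) set)))
    euclideanreal (\<lambda>V. grassmann_coords \<sigma> e V k)"
proof (cases "k < grassmannian_dim TYPE('r) TYPE('n)")
  case True
  have "continuous_map euclidean euclideanreal (\<lambda>A::real^'r^'n. A $ fst (e k) $ snd (e k))"
    by (simp add: continuous_intros)
  from continuous_map_compose[OF continuous_map_normal_frame_of this] True show ?thesis
    by (simp add: grassmann_coords_def normal_frame_of_def comp_def)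
qed (simp add: grassmann_coords_def)

section \<open>Compactness and partial derivatives\<close>

text \<open>
  If no minimum were attained, each \<open>p\<close> would have a better point \<open>m p\<close>, and the open sets where
  \<open>f\<close> exceeds \<open>f (m p)\<close> would cover \<open>S\<close>. In a finite subcover, the lowest of the finitely many
  points \<open>m p\<close> would lie in none of the sets.
\<close>

lemma compactin_lsc_attains_min:
  fixes f :: "'a \<Rightarrow> real"
  assumes S: "compactin X S" "S \<noteq> {}"
    and lsc: "\<And>p c. \<lbrakk>p \<in> S; c < f p\<rbrakk> \<Longrightarrow> \<exists>W. openin X W \<and> p \<in> W \<and> (\<forall>q\<in>W \<inter> S. c < f q)"
  obtains p where "p \<in> S" "\<And>q. q \<in> S \<Longrightarrow> f p \<le> f q"
proof -
  have "\<exists>p\<in>S. \<forall>q\<in>S. f p \<le> f q"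
  proof (rule ccontr)
    assume "\<not> ?thesis"
    then have "\<forall>p\<in>S. \<exists>q\<in>S. f q < f p"
      by (simp add: not_le)
    then obtain m where m: "\<And>p. p \<in> S \<Longrightarrow> m p \<in> S \<and> f (m p) < f p"
      by metis
    then have "\<forall>p\<in>S. \<exists>W. openin X W \<and> p \<in> W \<and> (\<forall>q\<in>W \<inter> S. f (m p) < f q)"
      using lsc by blast
    then obtain W where W: "\<And>p. p \<in> S \<Longrightarrow> openin X (W p) \<and> p \<in> W p \<and> (\<forall>q\<in>W p \<inter> S. f (m p) < f q)"
      by metis
    then have "\<And>T. T \<in> W ` S \<Longrightarrow> openin X T" "S \<subseteq> \<Union>(W ` S)"
      by auto
    then obtain \<F> where "finite \<F>" "\<F> \<subseteq> W ` S" "S \<subseteq> \<Union>\<F>"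
      using compactinD[OF S(1)] by meson
    then obtain F where F: "F \<subseteq> S" "finite F" "S \<subseteq> \<Union>(W ` F)"
      by (metis finite_subset_image)
    then have "F \<noteq> {}"
      using S(2) by blast
    then obtain p where p: "p \<in> F" "\<And>q. q \<in> F \<Longrightarrow> f (m p) \<le> f (m q)"
      using ex_is_arg_min_if_finite[OF F(2), of "f \<circ> m"] by (auto simp: is_arg_min_linorder)
    then have "m p \<in> S"
      using m F(1) by blast
    then obtain q where "q \<in> F" "m p \<in> W q"
      using F(3) by blast
    then have "f (m q) < f (m p)"
      using W F(1) \<open>m p \<in> S\<close> by blast
    with p(2)[OF \<open>q \<in> F\<close>] show False by simp
  qed
  with that show ?thesis by blast
qed

lemma compactin_uniform_bound:
  fixes P :: "real \<Rightarrow> 'a \<Rightarrow> bool"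
  assumes S: "compactin X S"
    and mono: "\<And>a b p. \<lbrakk>a \<le> b; P a p\<rbrakk> \<Longrightarrow> P b p"
    and loc: "\<And>p. p \<in> S \<Longrightarrow> \<exists>W a. openin X W \<and> p \<in> W \<and> (\<forall>q\<in>W. P a q)"
  obtains a where "a \<ge> 0" "\<And>p. p \<in> S \<Longrightarrow> P a p"
proof -
  have "\<forall>p\<in>S. \<exists>W a. openin X W \<and> p \<in> W \<and> (\<forall>q\<in>W. P a q)"
    using loc by blast
  then obtain W a where W: "\<And>p. p \<in> S \<Longrightarrow> openin X (W p) \<and> p \<in> W p \<and> (\<forall>q\<in>W p. P (a p) q)"
    by metis
  then have "\<And>T. T \<in> W ` S \<Longrightarrow> openin X T" "S \<subseteq> \<Union>(W ` S)"
    by auto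
  then obtain \<F> where "finite \<F>" "\<F> \<subseteq> W ` S" "S \<subseteq> \<Union>\<F>"
    using compactinD[OF S(1)] by meson
  then obtain F where F: "F \<subseteq> S" "finite F" "S \<subseteq> \<Union>(W ` F)"
    by (metis finite_subset_image)
  define b where "b = Max (insert 0 (a ` F))"
  have "P b p" if p: "p \<in> S" for p
  proof -
    obtain q where q: "q \<in> F" "p \<in> W q"
      using F(3) p by blast
    then have "P (a q) p"
      using W F(1) by blast
    moreover have "a q \<le> b"
      using F(2) q(1) by (simp add: b_def)
    ultimately show ?thesis
      using mono by blast
  qed
  moreover have "b \<ge> 0"
    using F(2) by (simp add: b_def)
  ultimately show ?thesis
    using that by blast
qed

definition join_coords :: "nat \<Rightarrow> (nat \<Rightarrow> real) \<Rightarrow> (nat \<Rightarrow> real) \<Rightarrow> nat \<Rightarrow> real"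
  where "join_coords d a b = (\<lambda>i. if i < d then a i else b (i - d))"

lemma join_coords_upd: "(join_coords d a b)(d + k := t) = join_coords d a (b(k := t))"
  by (auto simp: join_coords_def fun_eq_iff)

text \<open>
  Changing the coordinates from \<open>0\<close> to \<open>b k\<close> one after the other reduces the claim to the mean value
  theorem in one variable. The intermediate points stay in any set that contains the box
  spanned by \<open>b\<close>. The first \<open>d\<close> coordinates, those of the other factor, stay fixed.
\<close>

lemma lipschitz_from_partial_derivs:
  fixes f :: "(nat \<Rightarrow> real) \<Rightarrow> real"
  assumes diff: "\<And>k y. \<lbrakk>k < N; y \<in> S\<rbrakk> \<Longrightarrow> (\<lambda>t. f (y(d + k := t))) differentiable (at (y (d + k)))"
    and bound: "\<And>k y. \<lbrakk>k < N; y \<in> S\<rbrakk> \<Longrightarrow> \<bar>partial_deriv (d + k) f y\<bar> \<le> K"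
    and box: "\<And>b'. (\<And>k. \<bar>b' k\<bar> \<le> \<bar>b k\<bar>) \<Longrightarrow> join_coords d a b' \<in> S"
    and b: "\<And>k. k \<ge> N \<Longrightarrow> b k = 0"
  shows "\<bar>f (join_coords d a b) - f (join_coords d a (\<lambda>_. 0))\<bar> \<le> K * (\<Sum>k<N. \<bar>b k\<bar>)"
proof -
  define g where "g b = f (join_coords d a b)" for b
  define c where "c m k = (if k < m then b k else 0)" for m k :: nat
  have step: "\<bar>g (c (Suc m)) - g (c m)\<bar> \<le> K * \<bar>b m\<bar>" if m: "m < N" for m
  proof -
    define h where "h t = g ((c m)(m := t))" for t
    have h': "(h has_real_derivative partial_deriv (d + m) f (join_coords d a ((c m)(m := t)))) (at t)"
      "\<bar>partial_deriv (d + m) f (join_coords d a ((c m)(m := t)))\<bar> \<le> K"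
      if t: "\<bar>t\<bar> \<le> \<bar>b m\<bar>" for t
    proof -
      let ?y = "join_coords d a ((c m)(m := t))"
      have y: "?y \<in> S"
        using t by (intro box) (auto simp: c_def)
      have eq: "(\<lambda>t. f (?y(d + m := t))) = h" "?y (d + m) = t"
        by (auto simp: h_def g_def join_coords_upd) (simp add: join_coords_def)
      show "\<bar>partial_deriv (d + m) f ?y\<bar> \<le> K"
        by (rule bound[OF m y])
      show "(h has_real_derivative partial_deriv (d + m) f ?y) (at t)"
        using diff[OF m y] unfolding partial_deriv_def eq
        by (simp add: DERIV_deriv_iff_real_differentiable)
    qed
    have "norm (h (b m) - h 0) \<le> K * norm (b m - 0)"
    proof (rule field_differentiable_bound)
      show "convex (closed_segment 0 (b m))"
        by simp
      fix t assume "t \<in> closed_segment 0 (b m)"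
      then have "\<bar>t\<bar> \<le> \<bar>b m\<bar>"
        by (auto simp: closed_segment_eq_real_ivl split: if_splits)
      then show "(h has_field_derivative partial_deriv (d + m) f (join_coords d a ((c m)(m := t))))
          (at t within closed_segment 0 (b m))"
        and "norm (partial_deriv (d + m) f (join_coords d a ((c m)(m := t)))) \<le> K"
        using h' by (auto intro: has_field_derivative_at_within)
    qed auto
    moreover have "h (b m) = g (c (Suc m))"
      by (auto simp: h_def c_def intro!: arg_cong[where f = g])
    moreover have "h 0 = g (c m)"
      by (auto simp: h_def c_def intro!: arg_cong[where f = g])
    ultimately show ?thesis by simp
  qed
  have "g (c N) - g (c 0) = (\<Sum>m<N. g (c (Suc m)) - g (c m))"
    using sum_lessThan_telescope[of "\<lambda>m. g (c m)" N] by simp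
  then have "\<bar>g (c N) - g (c 0)\<bar> \<le> (\<Sum>m<N. K * \<bar>b m\<bar>)"
    using step by (auto intro!: order_trans[OF sum_abs] sum_mono)
  moreover have "c N = b"
    using b by (auto simp: c_def fun_eq_iff)
  moreover have "c 0 = (\<lambda>_. 0)"
    by (simp add: c_def fun_eq_iff)
  ultimately show ?thesis
    by (simp add: g_def sum_distrib_left)
qed

section \<open>Continuously differentiable functions on the product manifold\<close>

definition product_chart ::
    "nat \<Rightarrow> ('a \<Rightarrow> nat \<Rightarrow> real) \<Rightarrow> ('b \<Rightarrow> nat \<Rightarrow> real) \<Rightarrow> 'a \<times> 'b \<Rightarrow> nat \<Rightarrow> real"
  where "product_chart d \<phi> \<psi> = (\<lambda>(x, y). join_coords d (\<phi> x) (\<psi> y))"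

lemma product_chart_in_atlas:
  "(U, \<phi>) \<in> \<A> \<Longrightarrow> (V, \<psi>) \<in> \<B> \<Longrightarrow> (U \<times> V, product_chart d \<phi> \<psi>) \<in> product_atlas d \<A> \<B>"
  unfolding product_atlas_def product_chart_def join_coords_def by blast

lemma manifold_chart_cover:
  assumes "smooth_manifold d X \<A>" "x \<in> topspace X"
  obtains U \<phi> where "(U, \<phi>) \<in> \<A>" "x \<in> U"
proof -
  have "x \<in> \<Union> (fst ` \<A>)"
    using assms by (simp add: smooth_manifold_def)
  with that show ?thesis by force
qed

lemma manifold_chart_continuous:
  assumes "smooth_manifold d X \<A>" "(U, \<phi>) \<in> \<A>"
  shows "openin X U" "continuous_map (subtopology X U) (Euclidean_space d) \<phi>" "inj_on \<phi> U"
proof -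
  have U: "openin X U"
    and hom: "homeomorphic_map (subtopology X U) (subtopology (Euclidean_space d) (\<phi> ` U)) \<phi>"
    using assms by (auto simp: smooth_manifold_def)
  show "openin X U" by fact
  show "continuous_map (subtopology X U) (Euclidean_space d) \<phi>"
    using homeomorphic_imp_continuous_map[OF hom] by (simp add: continuous_map_in_subtopology)
  show "inj_on \<phi> U"
    using hom openin_subset[OF U] by (simp add: homeomorphic_map_def Int_absorb1 inf.absorb2 homeomorphic_eq_everything_map)
qed

lemma continuous_map_product_chart:
  assumes \<phi>: "continuous_map (subtopology X U) (Euclidean_space d) \<phi>"
    and \<psi>: "\<And>k. continuous_map (subtopology Y V) euclideanreal (\<lambda>y. \<psi> y k)"
    and \<psi>0: "\<And>y k. k \<ge> N \<Longrightarrow> \<psi> y k = 0"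
  shows "continuous_map (subtopology (prod_topology X Y) (U \<times> V)) (Euclidean_space (d + N))
    (product_chart d \<phi> \<psi>)"
proof -
  let ?P = "prod_topology (subtopology X U) (subtopology Y V)"
  have \<phi>k: "continuous_map (subtopology X U) euclideanreal (\<lambda>x. \<phi> x k)" for k
    using \<phi> by (simp add: Euclidean_space_def continuous_map_in_subtopology continuous_map_componentwise_UNIV)
  have "continuous_map ?P euclideanreal (\<lambda>p. product_chart d \<phi> \<psi> p k)" for k
  proof (cases "k < d")
    case True
    have "continuous_map ?P euclideanreal (\<lambda>p. \<phi> (fst p) k)"
      using continuous_map_compose[OF continuous_map_fst \<phi>k] by (simp add: comp_def)
    then show ?thesis
      using True by (simp add: product_chart_def join_coords_def case_prod_beta)
  next
    case False
    have "continuous_map ?P euclideanreal (\<lambda>p. \<psi> (snd p) (k - d))"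
      using continuous_map_compose[OF continuous_map_snd \<psi>] by (simp add: comp_def)
    then show ?thesis
      using False by (simp add: product_chart_def join_coords_def case_prod_beta)
  qed
  moreover have "product_chart d \<phi> \<psi> p i = 0" if "i \<ge> d + N" for p i
    using that \<psi>0 by (simp add: product_chart_def join_coords_def case_prod_beta)
  ultimately show ?thesis
    by (simp add: Euclidean_space_def continuous_map_in_subtopology continuous_map_componentwise_UNIV
        subtopology_Times image_subset_iff)
qed

lemma inj_on_product_chart:
  assumes \<phi>: "continuous_map (subtopology X U) (Euclidean_space d) \<phi>" "U \<subseteq> topspace X" "inj_on \<phi> U"
    and \<psi>: "inj_on \<psi> V"
  shows "inj_on (product_chart d \<phi> \<psi>) (U \<times> V)"
proof (rule inj_onI, clarify)
  fix x y x' y'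
  assume *: "x \<in> U" "y \<in> V" "x' \<in> U" "y' \<in> V"
    and eq: "product_chart d \<phi> \<psi> (x, y) = product_chart d \<phi> \<psi> (x', y')"
  have vanish: "\<phi> z i = 0" if "z \<in> U" "i \<ge> d" for z i
    using continuous_map_image_subset_topspace[OF \<phi>(1)] \<phi>(2) that by (auto simp: topspace_Euclidean_space)
  have "\<phi> x = \<phi> x'"
  proof
    fix i
    show "\<phi> x i = \<phi> x' i"
      using fun_cong[OF eq, of i] vanish[of x i] vanish[of x' i] *
      by (cases "i < d") (auto simp: product_chart_def join_coords_def)
  qed
  then have "x = x'"
    using \<phi>(3) * by (auto simp: inj_on_def)
  moreover have "\<psi> y = \<psi> y'"
  proof
    show "\<psi> y i = \<psi> y' i" for i
      using fun_cong[OF eq, of "d + i"] by (simp add: product_chart_def join_coords_def)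
  qed
  then have "y = y'"
    using \<psi> * by (auto simp: inj_on_def)
  ultimately show "x = x' \<and> y = y'" ..
qed

lemma continuous_map_pullback:
  assumes "continuous_map (subtopology X U) E \<phi>"
    and "continuous_map (subtopology E (\<phi> ` (U \<inter> D))) Z g"
  shows "continuous_map (subtopology X (U \<inter> D)) Z (g \<circ> \<phi>)"
proof (rule continuous_map_compose[OF _ assms(2)])
  have "continuous_map (subtopology X (U \<inter> D)) E \<phi>"
    using continuous_map_from_subtopology[OF assms(1), of D] by (simp add: subtopology_subtopology)
  then show "continuous_map (subtopology X (U \<inter> D)) (subtopology E (\<phi> ` (U \<inter> D))) \<phi>"
    by (auto simp: continuous_map_in_subtopology)
qed

lemma inj_on_grassmann_coords:
  fixes \<sigma> :: "'r::finite \<Rightarrow> 'n::finite"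
  assumes "bij_betw e {..<grassmannian_dim TYPE('r) TYPE('n)} ((- range \<sigma>) \<times> UNIV)"
  shows "inj_on (grassmann_coords \<sigma> e) (colspan ` (normal_frames \<sigma> :: (real^'r^'n) set))"
  using frame_with_coords[OF _ assms] by (intro inj_onI) (metis (no_types, lifting) imageE)

text \<open>
  Continuity of the coordinate representation \<open>f\<close> and of its partial derivatives is pulled back along
  the chart, so that neighbourhoods can be chosen on the manifold itself.
\<close>

lemma C1_product_chart:
  fixes \<sigma> :: "'r::finite \<Rightarrow> 'n::finite" and J :: "'m \<times> (real^'n) set \<Rightarrow> real"
  defines "N \<equiv> grassmannian_dim TYPE('r) TYPE('n)"
    and "V \<equiv> colspan ` (normal_frames \<sigma> :: (real^'r^'n) set)"
  assumes mfd: "smooth_manifold d X \<A>" and U: "(U, \<phi>) \<in> \<A>"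
    and \<sigma>: "inj \<sigma>" and e: "bij_betw e {..<N} ((- range \<sigma>) \<times> UNIV)"
    and C1: "Ck_on_manifold 1 (d + N) (product_atlas d \<A> (grassmann_atlas TYPE('r))) D J"
  defines "\<Phi> \<equiv> product_chart d \<phi> (grassmann_coords \<sigma> e)"
    and "P \<equiv> subtopology (prod_topology X (grassmann_topology TYPE('r))) (U \<times> V \<inter> D)"
  obtains f where "\<And>p. p \<in> U \<times> V \<inter> D \<Longrightarrow> f (\<Phi> p) = J p"
    "continuous_map P euclideanreal J"
    "\<And>i p. \<lbrakk>i < d + N; p \<in> U \<times> V \<inter> D\<rbrakk> \<Longrightarrow> (\<lambda>t. f ((\<Phi> p)(i := t))) differentiable (at (\<Phi> p i))"
    "\<And>i. i < d + N \<Longrightarrow> continuous_map P euclideanreal (\<lambda>p. partial_deriv i f (\<Phi> p))"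
proof
  define f where "f y = J (inv_into (U \<times> V) \<Phi> y)" for y
  note X = manifold_chart_continuous[OF mfd U]
  have "(V, grassmann_coords \<sigma> e) \<in> grassmann_atlas TYPE('r)"
    using \<sigma> e unfolding grassmann_atlas_def N_def V_def by blast
  then have "(U \<times> V, \<Phi>) \<in> product_atlas d \<A> (grassmann_atlas TYPE('r))"
    unfolding \<Phi>_def using U by (intro product_chart_in_atlas)
  then have Ck: "Ck_on 1 (d + N) (\<Phi> ` (U \<times> V \<inter> D)) f"
    using C1 unfolding Ck_on_manifold_def f_def by blast
  have \<Phi>: "continuous_map (subtopology (prod_topology X (grassmann_topology TYPE('r))) (U \<times> V))
      (Euclidean_space (d + N)) \<Phi>"
    unfolding \<Phi>_def V_def using X(2)
    by (intro continuous_map_product_chart continuous_map_grassmann_coords)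
      (auto simp: grassmann_coords_def N_def)
  have "inj_on \<Phi> (U \<times> V)"
    unfolding \<Phi>_def V_def using X openin_subset[OF X(1)] e
    by (intro inj_on_product_chart inj_on_grassmann_coords) (auto simp: N_def)
  then show fJ: "f (\<Phi> p) = J p" if "p \<in> U \<times> V \<inter> D" for p
    using that by (simp add: f_def)
  have "continuous_map (subtopology (Euclidean_space (d + N)) (\<Phi> ` (U \<times> V \<inter> D))) euclideanreal f"
    using Ck by simp
  from continuous_map_pullback[OF \<Phi> this] show "continuous_map P euclideanreal J"
    unfolding P_def by (rule continuous_map_eq) (use fJ in auto)
  show "(\<lambda>t. f ((\<Phi> p)(i := t))) differentiable (at (\<Phi> p i))"
    if "i < d + N" "p \<in> U \<times> V \<inter> D" for i p
    using Ck that by auto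
  show "continuous_map P euclideanreal (\<lambda>p. partial_deriv i f (\<Phi> p))" if "i < d + N" for i
  proof -
    have "continuous_map (subtopology (Euclidean_space (d + N)) (\<Phi> ` (U \<times> V \<inter> D))) euclideanreal
        (partial_deriv i f)"
      using Ck that by simp
    from continuous_map_pullback[OF \<Phi> this] show ?thesis
      by (simp add: P_def comp_def)
  qed
qed

lemma openin_sublevel:
  assumes "openin X U" "continuous_map (subtopology X U) euclideanreal h"
  shows "openin X {p \<in> U. h p < c}"
proof -
  have "openin (subtopology X U) {p \<in> topspace (subtopology X U). h p \<in> {..<c}}"
    by (rule openin_continuous_map_preimage[OF assms(2)]) simp
  moreover have "{p \<in> topspace (subtopology X U). h p \<in> {..<c}} = {p \<in> U. h p < c}"
    using openin_subset[OF assms(1)] by auto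
  ultimately show ?thesis
    using openin_trans_full[OF _ assms(1)] by metis
qed

lemma C1_on_product_lsc:
  fixes J :: "'m \<times> (real^'n::finite) set \<Rightarrow> real"
  assumes mfd: "smooth_manifold d X \<A>"
    and D: "openin (prod_topology X (grassmann_topology TYPE('r::finite))) D"
    and C1: "Ck_on_manifold 1 (d + grassmannian_dim TYPE('r) TYPE('n))
           (product_atlas d \<A> (grassmann_atlas TYPE('r))) D J"
    and p: "p \<in> D" "c < J p"
  obtains W where "openin (prod_topology X (grassmann_topology TYPE('r))) W" "p \<in> W" "W \<subseteq> D"
    "\<And>q. q \<in> W \<Longrightarrow> c < J q"
proof -
  obtain x V where [simp]: "p = (x, V)"
    by (cases p)
  have "x \<in> topspace X" and V: "V \<in> grassmannian TYPE('r)"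
    using openin_subset[OF D] p(1) by (auto simp: topspace_grassmann_topology)
  then obtain U \<phi> where U: "(U, \<phi>) \<in> \<A>" "x \<in> U"
    using manifold_chart_cover[OF mfd] by blast
  obtain \<sigma> :: "'r \<Rightarrow> 'n" where \<sigma>: "inj \<sigma>" "V \<in> colspan ` (normal_frames \<sigma> :: (real^'r^'n) set)"
    using grassmannian_chart_cover[OF V] .
  obtain e where e: "bij_betw e {..<grassmannian_dim TYPE('r) TYPE('n)} ((- range \<sigma>) \<times> (UNIV :: 'r set))"
    using ex_entry_enumeration[OF \<sigma>(1)] .
  let ?C = "U \<times> colspan ` (normal_frames \<sigma> :: (real^'r^'n) set) \<inter> D"
  have J: "continuous_map (subtopology (prod_topology X (grassmann_topology TYPE('r))) ?C) euclideanreal J"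
    using C1_product_chart[OF mfd U(1) \<sigma>(1) e C1] by metis
  have "openin (prod_topology X (grassmann_topology TYPE('r))) ?C"
    using manifold_chart_continuous(1)[OF mfd U(1)] D
    by (simp add: openin_Int openin_prod_Times_iff openin_grassmann_chart)
  then have "openin (prod_topology X (grassmann_topology TYPE('r))) {q \<in> ?C. - J q < - c}"
    by (rule openin_sublevel) (rule continuous_map_minus[OF J])
  then show ?thesis
    by (rule that) (use p U(2) \<sigma>(2) in auto)
qed

lemma openin_prod_basic_nhd:
  assumes "openin (prod_topology X Y) W" "(x, y) \<in> W"
  obtains A B where "openin X A" "openin Y B" "x \<in> A" "y \<in> B" "A \<times> B \<subseteq> W"
proof -
  have "\<exists>A B. openin X A \<and> openin Y B \<and> x \<in> A \<and> y \<in> B \<and> A \<times> B \<subseteq> W"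
    using assms by (simp add: openin_prod_topology_alt)
  with that show ?thesis by metis
qed

text \<open>
  Near a point where the penalty vanishes, moving only the subspace to \<open>V\<^sub>0\<close> increases \<open>J\<close> by at most
  a constant times the penalty. For in the standard chart centred at the coordinate subspace \<open>V\<^sub>0\<close> the
  increase is at most \<open>K\<close> times the \<open>\<ell>\<^sub>1\<close> norm of the coordinates, where \<open>K\<close> bounds the
  partial derivatives, and that norm is bounded by the penalty through \<open>R12_sharp\<close>.
\<close>

lemma penalty_dominates_locally:
  fixes J :: "'m \<times> (real^'n::finite) set \<Rightarrow> real"
  assumes mfd: "smooth_manifold d X \<A>"
    and D: "openin (prod_topology X (grassmann_topology TYPE('r::finite))) D"
    and C1: "Ck_on_manifold 1 (d + grassmannian_dim TYPE('r) TYPE('n))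
           (product_atlas d \<A> (grassmann_atlas TYPE('r))) D J"
    and p: "(x\<^sub>0, V\<^sub>0) \<in> D" "R12 TYPE('r) V\<^sub>0 = 0"
  obtains W \<Gamma> where "openin (prod_topology X (grassmann_topology TYPE('r))) W" "(x\<^sub>0, V\<^sub>0) \<in> W"
    "\<And>x V. (x, V) \<in> W \<Longrightarrow> (x, V\<^sub>0) \<in> D \<and> J (x, V\<^sub>0) - J (x, V) \<le> \<Gamma> * R12 TYPE('r) V"
proof -
  let ?N = "grassmannian_dim TYPE('r) TYPE('n)"
  let ?P = "prod_topology X (grassmann_topology TYPE('r) :: (real^'n) set topology)"
  define r n where "r = real CARD('r)" and "n = real CARD('n)"
  have "x\<^sub>0 \<in> topspace X" and V0: "V\<^sub>0 \<in> grassmannian TYPE('r)"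
    using openin_subset[OF D] p(1) by (auto simp: topspace_grassmann_topology)
  then obtain U \<phi> where U: "(U, \<phi>) \<in> \<A>" "x\<^sub>0 \<in> U"
    using manifold_chart_cover[OF mfd] by blast
  obtain \<sigma> :: "'r \<Rightarrow> 'n" where \<sigma>: "inj \<sigma>" "V\<^sub>0 = colspan (coordinate_frame \<sigma> :: real^'r^'n)"
    using R12_zero_imp_coordinate_subspace[OF V0 p(2)] .
  obtain e where e: "bij_betw e {..<?N} ((- range \<sigma>) \<times> (UNIV :: 'r set))"
    using ex_entry_enumeration[OF \<sigma>(1)] .
  define \<psi> :: "(real^'n) set \<Rightarrow> nat \<Rightarrow> real" where "\<psi> = grassmann_coords \<sigma> e"
  define C where "C = colspan ` (normal_frames \<sigma> :: (real^'r^'n) set)"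
  define \<Phi> where "\<Phi> = product_chart d \<phi> \<psi>"
  have V0C: "V\<^sub>0 \<in> C"
    unfolding C_def \<sigma>(2) by (intro imageI coordinate_frame_normal[OF \<sigma>(1)])
  obtain f where f: "\<And>p. p \<in> U \<times> C \<inter> D \<Longrightarrow> f (\<Phi> p) = J p"
    "\<And>i p. \<lbrakk>i < d + ?N; p \<in> U \<times> C \<inter> D\<rbrakk> \<Longrightarrow> (\<lambda>t. f ((\<Phi> p)(i := t))) differentiable (at (\<Phi> p i))"
    "\<And>i. i < d + ?N \<Longrightarrow> continuous_map (subtopology ?P (U \<times> C \<inter> D)) euclideanreal
       (\<lambda>p. partial_deriv i f (\<Phi> p))"
    using C1_product_chart[OF mfd U(1) \<sigma>(1) e C1] unfolding C_def \<Phi>_def \<psi>_def by metis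
  define h where "h p = (\<Sum>k<?N. \<bar>partial_deriv (d + k) f (\<Phi> p)\<bar>)" for p
  define K where "K = h (x\<^sub>0, V\<^sub>0) + 1"
  have openUC: "openin ?P (U \<times> C \<inter> D)"
    using manifold_chart_continuous(1)[OF mfd U(1)] D
    by (simp add: openin_Int openin_prod_Times_iff openin_grassmann_chart C_def)
  have "continuous_map (subtopology ?P (U \<times> C \<inter> D)) euclideanreal h"
    unfolding h_def by (intro continuous_map_sum continuous_map_real_abs f(3)) auto
  then have open_W: "openin ?P {p \<in> U \<times> C \<inter> D. h p < K}"
    by (rule openin_sublevel[OF openUC])
  have mem_W: "(x\<^sub>0, V\<^sub>0) \<in> {p \<in> U \<times> C \<inter> D. h p < K}"
    using p(1) U(2) V0C by (simp add: K_def)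
  obtain A B where AB: "openin X A" "openin (grassmann_topology TYPE('r)) B"
    "x\<^sub>0 \<in> A" "V\<^sub>0 \<in> B" "A \<times> B \<subseteq> {p \<in> U \<times> C \<inter> D. h p < K}"
    using openin_prod_basic_nhd[OF open_W mem_W] .
  have bound: "\<bar>partial_deriv (d + k) f (\<Phi> p)\<bar> \<le> K" if k: "k < ?N" and p: "p \<in> A \<times> B" for k p
  proof -
    have "\<bar>partial_deriv (d + k) f (\<Phi> p)\<bar> \<le> h p"
      unfolding h_def using k by (intro member_le_sum) auto
    also have "h p < K"
      using p AB(5) by blast
    finally show ?thesis by simp
  qed
  have "K \<ge> 0"
    by (simp add: K_def h_def sum_nonneg add_nonneg_nonneg)
  obtain \<delta>\<^sub>1 where \<delta>1: "\<delta>\<^sub>1 > 0"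
    "\<And>A :: real^'r^'n. \<lbrakk>A \<in> normal_frames \<sigma>; \<And>i j. i \<notin> range \<sigma> \<Longrightarrow> \<bar>A $ i $ j\<bar> < \<delta>\<^sub>1\<rbrakk> \<Longrightarrow> colspan A \<in> B"
    using colspan_box_in_open[OF AB(2) \<sigma>(1)] AB(4) \<sigma>(2) by metis
  \<comment> \<open>Below \<open>\<delta>\<^sub>1\<close> the box stays where the derivatives are bounded; below \<open>1 / (2 * r)\<close> the
    penalty grows linearly.\<close>
  define \<delta> where "\<delta> = min \<delta>\<^sub>1 (1 / (2 * r))"
  have "\<delta> > 0"
    using \<delta>1(1) by (simp add: \<delta>_def r_def)
  define B' where "B' = {V \<in> C. (\<Sum>k<?N. \<bar>\<psi> V k\<bar>) < \<delta>}"
  have "openin (grassmann_topology TYPE('r)) B'"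
    unfolding B'_def C_def \<psi>_def
    by (intro openin_sublevel openin_grassmann_chart continuous_map_sum continuous_map_real_abs
        continuous_map_grassmann_coords) auto
  then have "openin ?P (A \<times> B')"
    using AB(1) by (simp add: openin_prod_Times_iff)
  have frame0: "frame_with \<sigma> e (\<lambda>_. 0) = coordinate_frame \<sigma>"
    by (auto simp: frame_with_def coordinate_frame_def vec_eq_iff)
  have \<psi>0: "\<psi> V\<^sub>0 = (\<lambda>_. 0)"
    unfolding \<psi>_def \<sigma>(2) frame0[symmetric] by (rule grassmann_coords_frame_with[OF \<sigma>(1) e]) simp
  have "(x\<^sub>0, V\<^sub>0) \<in> A \<times> B'"
    using AB(3) V0C \<open>\<delta> > 0\<close> by (simp add: B'_def \<psi>0)
  have "(x, V\<^sub>0) \<in> D \<and> J (x, V\<^sub>0) - J (x, V) \<le> (K * (2 * n * r)) * R12 TYPE('r) V"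
    if xV: "(x, V) \<in> A \<times> B'" for x V
  proof -
    have x: "x \<in> A" and V: "V \<in> C" and sum: "(\<Sum>k<?N. \<bar>\<psi> V k\<bar>) < \<delta>"
      using xV by (auto simp: B'_def)
    have coords0: "\<psi> V k = 0" if "k \<ge> ?N" for k
      using that by (simp add: \<psi>_def grassmann_coords_def)
    have small: "\<bar>\<psi> V k\<bar> < \<delta>" for k
    proof (cases "k < ?N")
      case True
      then have "\<bar>\<psi> V k\<bar> \<le> (\<Sum>k<?N. \<bar>\<psi> V k\<bar>)"
        by (intro member_le_sum) auto
      with sum show ?thesis by simp
    qed (simp add: coords0 \<open>\<delta> > 0\<close>)
    have box: "join_coords d (\<phi> x) b \<in> \<Phi> ` (A \<times> B)" if b: "\<And>k. \<bar>b k\<bar> \<le> \<bar>\<psi> V k\<bar>" for b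
    proof -
      have "b k = 0" if "k \<ge> ?N" for k
        using b[of k] coords0[OF that] by simp
      then have "\<psi> (colspan (frame_with \<sigma> e b)) = b"
        unfolding \<psi>_def by (intro grassmann_coords_frame_with[OF \<sigma>(1) e]) auto
      then have "join_coords d (\<phi> x) b = \<Phi> (x, colspan (frame_with \<sigma> e b))"
        by (simp add: \<Phi>_def product_chart_def)
      moreover have "\<bar>b k\<bar> < \<delta>\<^sub>1" for k
        using order_le_less_trans[OF b small, of k] by (simp add: \<delta>_def)
      then have "colspan (frame_with \<sigma> e b) \<in> B"
        by (intro \<delta>1(2) frame_with_normal[OF \<sigma>(1)]) (simp add: frame_with_def)
      ultimately show ?thesis
        using x by blast
    qed
    obtain F :: "real^'r^'n" where F: "F \<in> normal_frames \<sigma>" "V = colspan F"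
      using V by (auto simp: C_def)
    have F': "F = frame_with \<sigma> e (\<psi> V)"
      unfolding F(2) \<psi>_def by (rule frame_with_coords[OF F(1) e, symmetric])
    have "V \<in> B"
      unfolding F(2)
    proof (rule \<delta>1(2)[OF F(1)])
      show "\<bar>F $ i $ j\<bar> < \<delta>\<^sub>1" if "i \<notin> range \<sigma>" for i j
        unfolding F' using that small by (simp add: frame_with_def \<delta>_def)
    qed
    then have D': "(x, V) \<in> U \<times> C \<inter> D" "(x, V\<^sub>0) \<in> U \<times> C \<inter> D"
      using AB(4,5) x by auto
    have "\<bar>f (join_coords d (\<phi> x) (\<psi> V)) - f (join_coords d (\<phi> x) (\<lambda>_. 0))\<bar> \<le> K * (\<Sum>k<?N. \<bar>\<psi> V k\<bar>)"
    proof (rule lipschitz_from_partial_derivs[where S = "\<Phi> ` (A \<times> B)"])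
      show "(\<lambda>t. f (y(d + k := t))) differentiable (at (y (d + k)))"
        if "k < ?N" "y \<in> \<Phi> ` (A \<times> B)" for k y
        using that f(2) AB(5) by auto
    qed (use bound box coords0 in auto)
    then have "J (x, V\<^sub>0) - J (x, V) \<le> K * (\<Sum>k<?N. \<bar>\<psi> V k\<bar>)"
      using f(1)[OF D'(1)] f(1)[OF D'(2)] by (simp add: \<Phi>_def product_chart_def \<psi>0)
    also have "(\<Sum>k<?N. \<bar>\<psi> V k\<bar>) = (\<Sum>k<?N. case e k of (i, j) \<Rightarrow> \<bar>F $ i $ j\<bar>)"
      by (intro sum.cong) (simp_all add: \<psi>_def F(2) grassmann_coords_colspan[OF F(1)] case_prod_beta)
    also have "\<dots> = (\<Sum>(i, j)\<in>(- range \<sigma>) \<times> UNIV. \<bar>F $ i $ j\<bar>)"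
      by (rule sum.reindex_bij_betw[OF e])
    also have "K * \<dots> \<le> K * (2 * n * r * R12 TYPE('r) V)"
      unfolding F(2) n_def r_def
    proof (intro mult_left_mono R12_sharp[OF F(1)] \<open>K \<ge> 0\<close>)
      show "\<bar>F $ i $ j\<bar> \<le> 1 / (2 * real CARD('r))" if "i \<notin> range \<sigma>" for i j
        unfolding F' using that small by (simp add: frame_with_def \<delta>_def r_def less_imp_le)
    qed
    finally show ?thesis
      using D' by (simp add: mult.assoc)
  qed
  with that \<open>openin ?P (A \<times> B')\<close> \<open>(x\<^sub>0, V\<^sub>0) \<in> A \<times> B'\<close> show ?thesis
    by blast
qed

section \<open>Exactness of the penalty\<close>

theorem theorem3:
  fixes d :: nat
    and X :: "'m topology"
    and \<A> :: "'m chart set"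
    and D :: "('m \<times> (real^'n) set) set"
    and J\<^sub>0 :: "'m \<times> (real^'n) set \<Rightarrow> real"
    and M :: real
  assumes "CARD('r::finite) \<le> CARD('n)"
    and "smooth_manifold d X \<A>"
    and "openin (prod_topology X (grassmann_topology TYPE('r))) D"
    and "\<forall>p\<in>D. J\<^sub>0 p \<ge> 0"
    and "Ck_on_manifold 1 (d + grassmannian_dim TYPE('r) TYPE('n))
           (product_atlas d \<A> (grassmann_atlas TYPE('r))) D J\<^sub>0"
    and "compactin (prod_topology X (grassmann_topology TYPE('r))) {p \<in> D. J\<^sub>0 p \<le> M}"
    and "\<exists>(x\<^sub>0, V\<^sub>0) \<in> {p \<in> D. J\<^sub>0 p \<le> M}. R12 TYPE('r) V\<^sub>0 = 0"
  shows "(\<forall>\<gamma>\<ge>0.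
            (\<exists>p. is_arg_min (penalized TYPE('r) J\<^sub>0 \<gamma>) (\<lambda>p. p \<in> D) p) \<and>
            (\<forall>p. is_arg_min (penalized TYPE('r) J\<^sub>0 \<gamma>) (\<lambda>p. p \<in> D) p \<longrightarrow>
                 p \<in> {p \<in> D. J\<^sub>0 p \<le> M})) \<and>
         (\<exists>\<Gamma>\<ge>0. \<forall>\<gamma>>\<Gamma>. \<forall>x V.
            is_arg_min (penalized TYPE('r) J\<^sub>0 \<gamma>) (\<lambda>p. p \<in> D) (x, V) \<longrightarrow> R12 TYPE('r) V = 0)"
proof -
  let ?P = "prod_topology X (grassmann_topology TYPE('r) :: (real^'n) set topology)"
  let ?S = "{p \<in> D. J\<^sub>0 p \<le> M}"
  let ?R = "R12 TYPE('r) :: (real^'n) set \<Rightarrow> real"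
  let ?J = "penalized TYPE('r) J\<^sub>0"
  let ?min = "\<lambda>\<gamma>. is_arg_min (?J \<gamma>) (\<lambda>p. p \<in> D)"
  note mfd = assms(2) and D = assms(3) and nonneg = assms(4) and C1 = assms(5) and compact = assms(6)
  obtain x\<^sub>0 V\<^sub>0 where p0: "(x\<^sub>0, V\<^sub>0) \<in> D" "J\<^sub>0 (x\<^sub>0, V\<^sub>0) \<le> M" "?R V\<^sub>0 = 0"
    using assms(7) by auto
  have grass: "V \<in> grassmannian TYPE('r)" if "(x, V) \<in> D" for x V
    using that openin_subset[OF D] by (auto simp: topspace_grassmann_topology)
  have R: "?R V \<ge> 0" if "(x, V) \<in> D" for x V
    using R12_nonneg[OF grass[OF that]] .
  have J: "?J \<gamma> (x, V) = J\<^sub>0 (x, V) + \<gamma> * ?R V" for \<gamma> x V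
    by (simp add: penalized_def)
  have min_le_M: "J\<^sub>0 (x, V) + \<gamma> * ?R V \<le> M" if "?min \<gamma> (x, V)" for \<gamma> x V
  proof -
    have "?J \<gamma> (x, V) \<le> ?J \<gamma> (x\<^sub>0, V\<^sub>0)"
      using that p0(1) by (auto simp: is_arg_min_linorder)
    with p0 show ?thesis
      by (simp add: J)
  qed
  have min_in_S: "p \<in> ?S" if "\<gamma> \<ge> 0" "?min \<gamma> p" for \<gamma> p
  proof -
    obtain x V where p: "p = (x, V)"
      by (cases p)
    then have "(x, V) \<in> D"
      using that(2) by (simp add: is_arg_min_def)
    moreover have "\<gamma> * ?R V \<ge> 0"
      using that(1) R[OF \<open>(x, V) \<in> D\<close>] by simp
    ultimately show ?thesis
      using min_le_M that(2) p by fastforce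
  qed
  have ex_min: "\<exists>p. ?min \<gamma> p" if \<gamma>: "\<gamma> \<ge> 0" for \<gamma>
  proof -
    have lsc: "\<exists>W. openin ?P W \<and> p \<in> W \<and> (\<forall>q\<in>W \<inter> ?S. c < ?J \<gamma> q)"
      if p: "p \<in> ?S" and c: "c < ?J \<gamma> p" for p c
    proof -
      obtain x V where [simp]: "p = (x, V)"
        by (cases p)
      \<comment> \<open>Half of the gap is allotted to the objective and half to the penalty term; \<open>\<gamma> + 1\<close>
        avoids a division by zero.\<close>
      define \<eta> where "\<eta> = (?J \<gamma> p - c) / 2"
      have "\<eta> > 0"
        using c by (simp add: \<eta>_def)
      have "(x, V) \<in> D"
        using p by simp
      have below: "J\<^sub>0 (x, V) - \<eta> < J\<^sub>0 (x, V)" "?R V - \<eta> / (\<gamma> + 1) < ?R V"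
        using \<open>\<eta> > 0\<close> \<gamma> by auto
      obtain A where A: "openin ?P A" "(x, V) \<in> A" "\<And>q. q \<in> A \<Longrightarrow> J\<^sub>0 (x, V) - \<eta> < J\<^sub>0 q"
        using C1_on_product_lsc[OF mfd D C1 \<open>(x, V) \<in> D\<close> below(1)] by metis
      obtain B where B: "openin (grassmann_topology TYPE('r)) B" "V \<in> B"
        "\<And>V'. V' \<in> B \<Longrightarrow> ?R V - \<eta> / (\<gamma> + 1) < ?R V'"
        using R12_lower_semicontinuous[OF grass[OF \<open>(x, V) \<in> D\<close>] below(2)] by blast
      have "openin ?P (A \<inter> topspace X \<times> B)"
        using A(1) B(1) by (simp add: openin_Int openin_prod_Times_iff)
      moreover have "p \<in> A \<inter> topspace X \<times> B"
        using A(2) B(2) openin_subset[OF A(1)] by auto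
      moreover have "c < ?J \<gamma> (x', V')" if q: "(x', V') \<in> A \<inter> topspace X \<times> B" for x' V'
      proof -
        have "\<gamma> * (?R V - ?R V') \<le> \<gamma> * (\<eta> / (\<gamma> + 1))"
          using B(3)[of V'] q \<gamma> by (intro mult_left_mono) auto
        also have "\<dots> \<le> \<eta>"
          using \<open>\<eta> > 0\<close> \<gamma> by (simp add: field_simps)
        finally have "\<gamma> * ?R V - \<gamma> * ?R V' \<le> \<eta>"
          by (simp add: algebra_simps)
        moreover have "J\<^sub>0 (x, V) - \<eta> < J\<^sub>0 (x', V')"
          using A(3) q by blast
        moreover have "J\<^sub>0 (x, V) + \<gamma> * ?R V - c = 2 * \<eta>"
          by (simp add: \<eta>_def J)
        ultimately show ?thesis
          by (simp add: J)
      qed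
      ultimately show ?thesis
        by (intro exI[of _ "A \<inter> topspace X \<times> B"]) auto
    qed
    have nonempty: "?S \<noteq> {}"
      using p0 by blast
    obtain p where p: "p \<in> ?S" "\<And>q. q \<in> ?S \<Longrightarrow> ?J \<gamma> p \<le> ?J \<gamma> q"
      by (rule compactin_lsc_attains_min[OF compact nonempty lsc]) (assumption+, blast)
    have "?J \<gamma> p \<le> ?J \<gamma> q" if "q \<in> D" for q
    proof (cases "q \<in> ?S")
      case False
      obtain x V where [simp]: "q = (x, V)"
        by (cases q)
      have "?J \<gamma> p \<le> ?J \<gamma> (x\<^sub>0, V\<^sub>0)"
        using p0 by (intro p(2)) simp
      also have "\<dots> \<le> M"
        using p0 by (simp add: J)
      also have "M \<le> J\<^sub>0 q"
        using False that by simp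
      also have "\<dots> \<le> ?J \<gamma> q"
        using \<gamma> R[of x V] that by (simp add: J)
      finally show ?thesis .
    qed (rule p(2))
    with p(1) have "?min \<gamma> p"
      by (simp add: is_arg_min_linorder)
    then show ?thesis ..
  qed
  \<comment> \<open>Carrying \<open>\<gamma> \<ge> 0\<close> along makes the signs of the local thresholds irrelevant.\<close>
  define exact where
    "exact a p \<longleftrightarrow> (\<forall>\<gamma>>a. \<gamma> \<ge> 0 \<longrightarrow> ?min \<gamma> p \<longrightarrow> ?R (snd p) = 0)" for a p
  have local: "\<exists>W a. openin ?P W \<and> p \<in> W \<and> (\<forall>q\<in>W. exact a q)" if p: "p \<in> ?S" for p
  proof -
    obtain x V where [simp]: "p = (x, V)"
      by (cases p)
    have pD: "(x, V) \<in> D"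
      using p by simp
    show ?thesis
    proof (cases "?R V = 0")
      case True
      \<comment> \<open>A minimizer cannot be improved by replacing its subspace with \<open>V\<close>.\<close>
      obtain W \<Gamma> where W: "openin ?P W" "(x, V) \<in> W"
        "\<And>x' V'. (x', V') \<in> W \<Longrightarrow> (x', V) \<in> D \<and> J\<^sub>0 (x', V) - J\<^sub>0 (x', V') \<le> \<Gamma> * ?R V'"
        using penalty_dominates_locally[OF mfd D C1 pD True] by metis
      have "exact \<Gamma> (x', V')" if q: "(x', V') \<in> W" for x' V'
        unfolding exact_def
      proof (intro allI impI)
        fix \<gamma> assume \<gamma>: "\<gamma> > \<Gamma>" and min: "?min \<gamma> (x', V')"
        have "(x', V') \<in> D"
          using min by (simp add: is_arg_min_def)
        have "?J \<gamma> (x', V') \<le> ?J \<gamma> (x', V)"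
          using min W(3)[OF q] by (auto simp: is_arg_min_linorder)
        then have "\<gamma> * ?R V' \<le> \<Gamma> * ?R V'"
          using W(3)[OF q] True by (simp add: J)
        then have "(\<gamma> - \<Gamma>) * ?R V' \<le> 0"
          by (simp add: algebra_simps)
        then show "?R (snd (x', V')) = 0"
          using \<gamma> R[OF \<open>(x', V') \<in> D\<close>] by (simp add: mult_le_0_iff)
      qed
      then have "\<forall>q\<in>W. exact \<Gamma> q"
        by auto
      with W(1,2) show ?thesis
        using \<open>p = (x, V)\<close> by blast
    next
      case False
      \<comment> \<open>Where the penalty stays above a positive bound, a large weight on it would push the value
        above \<open>M\<close>, the bound provided by the known feasible point.\<close>
      define \<epsilon> where "\<epsilon> = ?R V / 2"
      have "\<epsilon> > 0"
        using False R[OF pD] by (simp add: \<epsilon>_def)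
      then have "\<epsilon> < ?R V"
        by (simp add: \<epsilon>_def)
      then obtain B where B: "openin (grassmann_topology TYPE('r)) B" "V \<in> B"
        "\<And>V'. V' \<in> B \<Longrightarrow> \<epsilon> < ?R V'"
        using R12_lower_semicontinuous[OF grass[OF pD]] by metis
      have "exact (M / \<epsilon>) (x', V')" if q: "V' \<in> B" for x' V'
        unfolding exact_def
      proof (intro allI impI)
        fix \<gamma> assume \<gamma>: "\<gamma> > M / \<epsilon>" "\<gamma> \<ge> 0" and min: "?min \<gamma> (x', V')"
        have "J\<^sub>0 (x', V') \<ge> 0"
          using nonneg min by (simp add: is_arg_min_def)
        then have "\<gamma> * ?R V' \<le> M"
          using min_le_M[OF min] by simp
        moreover have "\<gamma> * \<epsilon> \<le> \<gamma> * ?R V'"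
          using B(3)[OF q] \<gamma>(2) by (intro mult_left_mono) auto
        moreover have "M < \<gamma> * \<epsilon>"
          using \<gamma>(1) \<open>\<epsilon> > 0\<close> by (simp add: field_simps)
        ultimately show "?R (snd (x', V')) = 0" by simp
      qed
      moreover have "openin ?P (topspace X \<times> B)" "p \<in> topspace X \<times> B"
        using B(1,2) pD openin_subset[OF D] by (auto simp: openin_prod_Times_iff)
      ultimately show ?thesis
        by (intro exI[of _ "topspace X \<times> B"] exI[of _ "M / \<epsilon>"]) auto
    qed
  qed
  have mono: "exact b p" if "a \<le> b" "exact a p" for a b p
    using that unfolding exact_def by (meson le_less_trans)
  obtain \<Gamma> where \<Gamma>: "\<Gamma> \<ge> 0" "\<And>p. p \<in> ?S \<Longrightarrow> exact \<Gamma> p"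
    by (rule compactin_uniform_bound[of ?P ?S exact, OF compact mono local]) (assumption+, blast)
  have "?R V = 0" if "\<gamma> > \<Gamma>" "?min \<gamma> (x, V)" for \<gamma> x V
  proof -
    have "\<gamma> \<ge> 0"
      using \<Gamma>(1) that(1) by simp
    with \<Gamma>(2)[OF min_in_S[OF this that(2)]] that show ?thesis
      by (simp add: exact_def)
  qed
  with \<Gamma>(1) ex_min min_in_S show ?thesis
    by blast
qed

end
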